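(* Let $\mu$ be the uniform distribution on $\{0,1\}^k$ and let $0\le\epsilon<\frac12$ be fixed. For any protocol $\pi$ that $\epsilon$-computes $\mathsf{Par}_k^n$, $\mathsf{MIC}_{\mu^n}(\pi)=\Omega(kn)$, where the implicit constant may depend on $\epsilon$ but not on $k$, $n$ or $\pi$.
   Context: Model (asynchronous number-in-hand peer-to-peer model). There are $k$ players. Player $i$ receives an input $x_i\in\{0,1\}^n$, has a private random string $R_i$, and all players share a public random string $R^p$; the input $X\sim\mu^n$ ($n$ independent copies of a uniform $k$-bit vector, copy $p$ giving the $p$-th bits of the players) is independent of the randomness. Every pair of players is joined by a bidirectional link with finite but unbounded delivery time and FIFO order in each direction. The view of player $i$ consists of $x_i$, $R_i$, $R^p$ and the messages read so far. A protocol specifies, for each player $i$ and each local round $\ell\ge1$, functions of the view of player $i$ at the end of local round $\ell-1$ giving: a set of recipients and, for each recipient $j$, a self-delimiting message in $\{0,1\}^*$ sent by $i$ to $j$; a value in $\{0,1\}^*\cup\{\bot\}$ — if not $\bot$, player $i$ stops and outputs it; otherwise a set of players from each of which player $i$ then waits to read one complete message, ending the local round. $\Pi_{i,j}^s$ is the sequence of messages sent by $i$ to $j$, $\Pi_{i,j}^r$ the sequence of messages read by $i$ from $j$, $\Pi_i=(\Pi_{i,j}^s,\Pi_{i,j}^r)_{j\ne i}$. $\mathsf{Par}_k^n(x)=(\oplus_{i=1}^kx_i^1,\dots,\oplus_{i=1}^kx_i^n)$ must be output by player $1$; $\pi$ $\epsilon$-computes it if on every input and randomness every player eventually stops, and on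 every input player $1$ outputs the correct value with probability $\ge1-\epsilon$ (for each coordinate). Multi-party information cost (public randomness regarded as part of each $\Pi_i$): $$\mathsf{MIC}_{\mu^n}(\pi)=\sum_{i=1}^k\big(I(X_{-i};\Pi_i\mid X_iR_i)+I(X_i;\Pi_i\mid X_{-i}R_{-i})\big).$$ *)

theory Defs
  imports "HOL-Probability.Probability"
begin

section \<open>Protocols\<close>

text \<open>
  The players are the numbers 1, ..., k. Local rounds are numbered from 1.
  A random string is an infinite bit sequence; its law is chosen by the protocol, so that fair
  coins, finite strings (suitably encoded) and non-uniform sources are all covered.
\<close>

type_synonym msg = "bool list"
type_synonym rstring = "nat \<Rightarrow> bool"

definition rspace :: "rstring measure" where
  "rspace = PiM UNIV (\<lambda>_. count_space UNIV)"

text \<open>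
  Functions of a view: the input, the private string, the public string, and for every player
  j the sequence of messages read so far from j. As all reads of a local round are
  prescribed by earlier views, these sequences together with the local round number, which is
  passed separately, determine in which round each message was read.
\<close>

type_synonym 'a on_view = "bool list \<Rightarrow> rstring \<Rightarrow> rstring \<Rightarrow> (nat \<Rightarrow> msg list) \<Rightarrow> 'a"

text \<open>
  The first two arguments of \<open>send\<close>, \<open>decide\<close> and \<open>wait\<close> are the player and the local round.
  \<open>send\<close> gives the message for each player (\<open>None\<close> for a player who is not a recipient);
  in \<open>decide\<close>, \<open>None\<close> stands for \<open>\<bottom>\<close>.
\<close>

record protocol =
  send :: "nat \<Rightarrow> nat \<Rightarrow> (nat \<Rightarrow> msg option) on_view"
  decide :: "nat \<Rightarrow> nat \<Rightarrow> bool list option on_view"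
  wait :: "nat \<Rightarrow> nat \<Rightarrow> nat set on_view"
  priv_law :: "nat \<Rightarrow> rstring measure"
  pub_law :: "rstring measure"

definition others :: "nat \<Rightarrow> nat \<Rightarrow> nat set" where
  "others k i = {1..k} - {i}"

text \<open>
  The measurability requirements say that what a player does is an event in the random strings;
  without them the probabilities below would be meaningless.
  A message is sent and read as one unit. This is what self-delimitation is for, and no
  prefix-freeness has to be imposed on the strings that are used as messages.
\<close>

definition is_protocol :: "nat \<Rightarrow> protocol \<Rightarrow> bool" where
  "is_protocol k \<pi> \<longleftrightarrow>
     (\<forall>i\<in>{1..k}. prob_space (priv_law \<pi> i) \<and> sets (priv_law \<pi> i) = sets rspace) \<and>
     prob_space (pub_law \<pi>) \<and> sets (pub_law \<pi>) = sets rspace \<and>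
     (\<forall>i\<in>{1..k}. \<forall>l\<ge>1. \<forall>x g.
        (\<forall>r p j. send \<pi> i l x r p g j \<noteq> None \<longrightarrow> j \<in> others k i) \<and>
        (\<forall>r p. wait \<pi> i l x r p g \<subseteq> others k i) \<and>
        (\<forall>j. (\<lambda>(r, p). send \<pi> i l x r p g j) \<in> rspace \<Otimes>\<^sub>M rspace \<rightarrow>\<^sub>M count_space UNIV) \<and>
        (\<lambda>(r, p). decide \<pi> i l x r p g) \<in> rspace \<Otimes>\<^sub>M rspace \<rightarrow>\<^sub>M count_space UNIV \<and>
        (\<forall>j. (\<lambda>(r, p). j \<in> wait \<pi> i l x r p g) \<in> rspace \<Otimes>\<^sub>M rspace \<rightarrow>\<^sub>M count_space UNIV))"

section \<open>Asynchronous executions\<close>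

text \<open>
  \<open>sent c i j\<close> is the sequence of all messages sent so far by i to j. Its first
  \<open>arrived c i j\<close> elements have been delivered to j (which gives FIFO order); the remaining
  ones are in transit. \<open>got c j i\<close> is the sequence of messages that j has read from i, always
  a prefix of the delivered ones. \<open>lround c i\<close> is the local round that i is in (\<open>Waiting\<close>) or
  is about to start (\<open>Ready\<close>).
\<close>

datatype status = Ready | Waiting | Stopped "bool list"

record config =
  status :: "nat \<Rightarrow> status"
  lround :: "nat \<Rightarrow> nat"
  sent :: "nat \<Rightarrow> nat \<Rightarrow> msg list"
  arrived :: "nat \<Rightarrow> nat \<Rightarrow> nat"
  got :: "nat \<Rightarrow> nat \<Rightarrow> msg list"

definition init :: config where
  "init = \<lparr>status = (\<lambda>_. Ready), lround = (\<lambda>_. 1), sent = (\<lambda>_ _. []),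
           arrived = (\<lambda>_ _. 0), got = (\<lambda>_ _. [])\<rparr>"

datatype event = Act nat | Deliver nat nat

definition start_round ::
  "protocol \<Rightarrow> (nat \<Rightarrow> bool list) \<Rightarrow> (nat \<Rightarrow> rstring) \<Rightarrow> rstring \<Rightarrow> nat \<Rightarrow> config \<Rightarrow> config" where
  "start_round \<pi> x r p i c = c\<lparr>
     sent := (sent c)(i := \<lambda>j.
       case send \<pi> i (lround c i) (x i) (r i) p (got c i) j of
         None \<Rightarrow> sent c i j
       | Some m \<Rightarrow> sent c i j @ [m]),
     status := (status c)(i :=
       case decide \<pi> i (lround c i) (x i) (r i) p (got c i) of
         None \<Rightarrow> Waiting
       | Some w \<Rightarrow> Stopped w)\<rparr>"

definition end_round ::
  "protocol \<Rightarrow> (nat \<Rightarrow> bool list) \<Rightarrow> (nat \<Rightarrow> rstring) \<Rightarrow> rstring \<Rightarrow> nat \<Rightarrow> config \<Rightarrow> config" where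
  "end_round \<pi> x r p i c =
     (let W = wait \<pi> i (lround c i) (x i) (r i) p (got c i) in
      if \<forall>j\<in>W. length (got c i j) < arrived c j i
      then c\<lparr>got := (got c)(i := \<lambda>j.
               if j \<in> W then got c i j @ [sent c j i ! length (got c i j)] else got c i j),
             status := (status c)(i := Ready),
             lround := (lround c)(i := Suc (lround c i))\<rparr>
      else c)"

fun step ::
  "protocol \<Rightarrow> (nat \<Rightarrow> bool list) \<Rightarrow> (nat \<Rightarrow> rstring) \<Rightarrow> rstring \<Rightarrow> event \<Rightarrow> config \<Rightarrow> config" where
  "step \<pi> x r p (Act i) c =
     (case status c i of
        Ready \<Rightarrow> start_round \<pi> x r p i c
      | Waiting \<Rightarrow> end_round \<pi> x r p i c
      | Stopped _ \<Rightarrow> c)"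
| "step \<pi> x r p (Deliver i j) c =
     (if arrived c i j < length (sent c i j)
      then c\<lparr>arrived := (arrived c)(i := (arrived c i)(j := Suc (arrived c i j)))\<rparr>
      else c)"

primrec run ::
  "protocol \<Rightarrow> (nat \<Rightarrow> bool list) \<Rightarrow> (nat \<Rightarrow> rstring) \<Rightarrow> rstring \<Rightarrow> (nat \<Rightarrow> event) \<Rightarrow> nat \<Rightarrow> config" where
  "run \<pi> x r p s 0 = init"
| "run \<pi> x r p s (Suc t) = step \<pi> x r p (s t) (run \<pi> x r p s t)"

definition events :: "nat \<Rightarrow> event set" where
  "events k = {Act i |i. i \<in> {1..k}} \<union> {Deliver i j |i j. i \<in> {1..k} \<and> j \<in> others k i}"

definition fair :: "nat \<Rightarrow> (nat \<Rightarrow> event) \<Rightarrow> bool" where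
  "fair k s \<longleftrightarrow> range s \<subseteq> events k \<and> (\<forall>e\<in>events k. \<exists>\<^sub>\<infinity>t. s t = e)"

text \<open>
  A scheduler fixes the delivery times and the speeds of the players. They are finite but
  unbounded (fairness) and may depend on the inputs and on all random strings.
\<close>

type_synonym scheduler =
  "(nat \<Rightarrow> bool list) \<Rightarrow> (nat \<Rightarrow> rstring) \<Rightarrow> rstring \<Rightarrow> nat \<Rightarrow> event"

definition is_scheduler :: "nat \<Rightarrow> scheduler \<Rightarrow> bool" where
  "is_scheduler k \<sigma> \<longleftrightarrow> (\<forall>x r p. fair k (\<sigma> x r p))"

definition stopped :: "config \<Rightarrow> nat \<Rightarrow> bool" where
  "stopped c i \<longleftrightarrow> (\<exists>w. status c i = Stopped w)"

text \<open>
  Once all players have stopped, nothing is sent or read any more. The transcripts and outputs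
  of an execution can thus be taken from the first configuration in which all have stopped.
\<close>

definition final ::
  "nat \<Rightarrow> protocol \<Rightarrow> scheduler \<Rightarrow> (nat \<Rightarrow> bool list) \<Rightarrow> (nat \<Rightarrow> rstring) \<Rightarrow> rstring \<Rightarrow> config" where
  "final k \<pi> \<sigma> x r p = run \<pi> x r p (\<sigma> x r p)
     (LEAST t. \<forall>i\<in>{1..k}. stopped (run \<pi> x r p (\<sigma> x r p) t) i)"

section \<open>Computing the parity function\<close>

definition Par :: "nat \<Rightarrow> nat \<Rightarrow> (nat \<Rightarrow> bool list) \<Rightarrow> bool list" where
  "Par k n x = map (\<lambda>q. odd (card {i\<in>{1..k}. x i ! q})) [0..<n]"

definition rand_law :: "nat \<Rightarrow> protocol \<Rightarrow> ((nat \<Rightarrow> rstring) \<times> rstring) measure" where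
  "rand_law k \<pi> = PiM {1..k} (priv_law \<pi>) \<Otimes>\<^sub>M pub_law \<pi>"

text \<open>The error bound is imposed on each coordinate of the output separately.\<close>

definition eps_computes_Par :: "nat \<Rightarrow> nat \<Rightarrow> real \<Rightarrow> protocol \<Rightarrow> bool" where
  "eps_computes_Par k n \<epsilon> \<pi> \<longleftrightarrow>
     (\<forall>\<sigma> x. is_scheduler k \<sigma> \<longrightarrow> (\<forall>i\<in>{1..k}. length (x i) = n) \<longrightarrow>
        (\<forall>r p. \<forall>i\<in>{1..k}. \<exists>t. stopped (run \<pi> x r p (\<sigma> x r p) t) i) \<and>
        (\<forall>q<n. measure (rand_law k \<pi>)
           {(r, p) \<in> space (rand_law k \<pi>). \<exists>w. status (final k \<pi> \<sigma> x r p) 1 = Stopped w \<and>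
              q < length w \<and> w ! q = Par k n x ! q} \<ge> 1 - \<epsilon>))"

section \<open>Information cost\<close>

definition \<mu> :: "nat \<Rightarrow> (nat \<Rightarrow> bool) measure" where
  "\<mu> k = uniform_count_measure ({1..k} \<rightarrow>\<^sub>E (UNIV :: bool set))"

definition \<mu>_pow :: "nat \<Rightarrow> nat \<Rightarrow> (nat \<Rightarrow> nat \<Rightarrow> bool) measure" where
  "\<mu>_pow k n = PiM {..<n} (\<lambda>_. \<mu> k)"

text \<open>An outcome consists of the n samples of \<open>\<mu> k\<close>, the private strings and the public string.\<close>

type_synonym outcome = "(nat \<Rightarrow> nat \<Rightarrow> bool) \<times> (nat \<Rightarrow> rstring) \<times> rstring"

definition joint :: "nat \<Rightarrow> nat \<Rightarrow> protocol \<Rightarrow> outcome measure" where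
  "joint k n \<pi> = \<mu>_pow k n \<Otimes>\<^sub>M rand_law k \<pi>"

definition X_of :: "nat \<Rightarrow> outcome \<Rightarrow> nat \<Rightarrow> bool list" where
  "X_of n = (\<lambda>(z, r, p) i. map (\<lambda>q. z q i) [0..<n])"

definition R_of :: "outcome \<Rightarrow> nat \<Rightarrow> rstring" where
  "R_of = (\<lambda>(z, r, p). r)"

definition X_minus :: "nat \<Rightarrow> nat \<Rightarrow> nat \<Rightarrow> outcome \<Rightarrow> nat \<Rightarrow> bool list" where
  "X_minus k n i \<omega> = restrict (X_of n \<omega>) (others k i)"

definition R_minus :: "nat \<Rightarrow> nat \<Rightarrow> outcome \<Rightarrow> nat \<Rightarrow> rstring" where
  "R_minus k i \<omega> = restrict (R_of \<omega>) (others k i)"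

text \<open>
  The transcript of player i: the public string, and for each other player j the messages sent
  to j and the messages read from j.
\<close>

definition transcript ::
  "nat \<Rightarrow> nat \<Rightarrow> protocol \<Rightarrow> scheduler \<Rightarrow> nat \<Rightarrow> outcome \<Rightarrow> rstring \<times> (nat \<Rightarrow> msg list \<times> msg list)" where
  "transcript k n \<pi> \<sigma> i = (\<lambda>(z, r, p).
     let c = final k \<pi> \<sigma> (X_of n (z, r, p)) r p
     in (p, \<lambda>j\<in>others k i. (sent c i j, got c i j)))"

definition transcript_space ::
  "nat \<Rightarrow> nat \<Rightarrow> (rstring \<times> (nat \<Rightarrow> msg list \<times> msg list)) measure" where
  "transcript_space k i = rspace \<Otimes>\<^sub>M PiM (others k i) (\<lambda>_. count_space UNIV)"

definition MIC :: "nat \<Rightarrow> nat \<Rightarrow> protocol \<Rightarrow> scheduler \<Rightarrow> real" where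
  "MIC k n \<pi> \<sigma> = (\<Sum>i=1..k.
     prob_space.conditional_mutual_information (joint k n \<pi>) 2
       (PiM (others k i) (\<lambda>_. count_space UNIV))
       (transcript_space k i)
       (count_space UNIV \<Otimes>\<^sub>M rspace)
       (X_minus k n i)
       (transcript k n \<pi> \<sigma> i)
       (\<lambda>\<omega>. (X_of n \<omega> i, R_of \<omega> i)) +
     prob_space.conditional_mutual_information (joint k n \<pi>) 2
       (count_space UNIV)
       (transcript_space k i)
       (PiM (others k i) (\<lambda>_. count_space UNIV) \<Otimes>\<^sub>M PiM (others k i) (\<lambda>_. rspace))
       (\<lambda>\<omega>. X_of n \<omega> i)
       (transcript k n \<pi> \<sigma> i)
       (\<lambda>\<omega>. (X_minus k n i \<omega>, R_minus k i \<omega>)))"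

end

theory Submission
  imports Defs "HOL-Library.Sublist"
begin

text \<open>
  Each term of the information cost is nonnegative, so it suffices to bound
  \<open>I(X\<^sub>i; \<Pi>\<^sub>i | X\<^sub>-\<^sub>i R\<^sub>-\<^sub>i)\<close> from below for each player \<open>i \<noteq> 1\<close>. As \<open>X\<^sub>i\<close> is independent of
  \<open>(X\<^sub>-\<^sub>i, R\<^sub>-\<^sub>i)\<close>, this is \<open>I(X\<^sub>i; \<Pi>\<^sub>i X\<^sub>-\<^sub>i R\<^sub>-\<^sub>i)\<close>. Player 1 receives information on
  \<open>X\<^sub>i\<close> only through the messages sent by player \<open>i\<close>, so \<open>(\<Pi>\<^sub>i, X\<^sub>-\<^sub>i, R\<^sub>-\<^sub>i)\<close> determines the
  output, and adding the parities of the other inputs to it gives a guess of every bit of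
  \<open>X\<^sub>i\<close>, each correct with probability at least \<open>1 - \<epsilon>\<close>. Gibbs' inequality turns this into
  a bound linear in \<open>n\<close>.
\<close>

section \<open>Independence of the scheduler\<close>

text \<open>Each step has an obstacle behind it. What the others know contains infinite random
  strings, so entropies are not at hand; a bounded test function in the variational formula for the
  divergence works for an arbitrary second variable, once the finite range of the input makes all
  integrals exist. Errors in different coordinates may be correlated, so the test function is a
  product, whose logarithm needs only the error of each coordinate. That a transcript determines the
  output is delicate: it keeps the message sequence of each link but not their interleaving, and the
  moves of player \<open>i\<close> cannot be recomputed without its private string. As every read
  names its sender, the interleaving does not affect the local states. The same fact makes
  executions independent of the scheduler, whose choices may depend on the random strings in a
  non-measurable way. Player 1 is left out because its output may depend on its own private string
  and need not show in what it sends or reads; this leaves \<open>k - 1\<close> terms.\<close>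

definition loc :: "config \<Rightarrow> nat \<Rightarrow> status \<times> nat \<times> (nat \<Rightarrow> msg list) \<times> (nat \<Rightarrow> msg list)" where
  "loc c i = (status c i, lround c i, sent c i, got c i)"

lemma loc_eqD:
  assumes "loc c i = loc c' i"
  shows "status c i = status c' i" "lround c i = lround c' i" "sent c i = sent c' i" "got c i = got c' i"
  using assms by (auto simp: loc_def)

text \<open>\<open>loc\<close> leaves out \<open>arrived\<close>, the component that deliveries
  change. All the rest belongs to a single player, including its row of \<open>sent\<close> and its
  row of \<open>got\<close>, and changes only when that player acts.\<close>

lemma loc_step_other: "e \<noteq> Act i \<Longrightarrow> loc (step \<pi> x r p e c) i = loc c i"
  by (cases e) (auto simp: loc_def start_round_def end_round_def Let_def split: status.split)

lemma loc_step_stopped: "status c i = Stopped w \<Longrightarrow> loc (step \<pi> x r p e c) i = loc c i"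
  by (cases "e = Act i") (auto simp: loc_step_other)

lemma sent_step_prefix: "prefix (sent c i j) (sent (step \<pi> x r p e c) i j)"
  by (cases e) (auto simp: start_round_def end_round_def Let_def split: status.split option.split)

lemma arrived_step_mono: "arrived c i j \<le> arrived (step \<pi> x r p e c) i j"
  by (cases e) (auto simp: start_round_def end_round_def Let_def split: status.split)

lemma arrived_le_step:
  assumes "\<forall>i j. arrived c i j \<le> length (sent c i j)"
  shows "arrived (step \<pi> x r p e c) i j \<le> length (sent (step \<pi> x r p e c) i j)"
proof (cases e)
  case (Act a)
  have "arrived (step \<pi> x r p e c) i j = arrived c i j"
    by (simp add: Act start_round_def end_round_def Let_def split: status.split)
  also have "\<dots> \<le> length (sent c i j)" using assms by blast
  also have "\<dots> \<le> length (sent (step \<pi> x r p e c) i j)"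
    by (rule prefix_length_le) (rule sent_step_prefix)
  finally show ?thesis .
next
  case (Deliver a b)
  show ?thesis using assms by (auto simp: Deliver Suc_le_eq)
qed

lemma arrived_le_sent: "arrived (run \<pi> x r p s t) i j \<le> length (sent (run \<pi> x r p s t) i j)"
proof (induction t arbitrary: i j)
  case (Suc t)
  then show ?case by (simp add: arrived_le_step)
qed (simp add: init_def)

lemma sent_run_mono: "t \<le> t' \<Longrightarrow> prefix (sent (run \<pi> x r p s t) i j) (sent (run \<pi> x r p s t') i j)"
proof (induction t' rule: dec_induct)
  case (step n)
  then show ?case using sent_step_prefix prefix_order.trans by fastforce
qed simp

lemma arrived_run_mono: "t \<le> t' \<Longrightarrow> arrived (run \<pi> x r p s t) i j \<le> arrived (run \<pi> x r p s t') i j"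
proof (induction t' rule: dec_induct)
  case (step n)
  then show ?case using arrived_step_mono order.trans by fastforce
qed simp

lemma lround_ge_1: "1 \<le> lround (run \<pi> x r p s t) i"
proof (induction t)
  case (Suc t)
  then show ?case
    by (cases "s t") (auto simp: start_round_def end_round_def Let_def split: status.split)
qed (simp add: init_def)

lemma loc_run_stopped:
  assumes "t \<le> t'" "status (run \<pi> x r p s t) i = Stopped w"
  shows "loc (run \<pi> x r p s t') i = loc (run \<pi> x r p s t) i"
  using assms
proof (induction t' rule: dec_induct)
  case (step n)
  then show ?case using loc_step_stopped[of "run \<pi> x r p s n" i w] by (auto dest: loc_eqD)
qed simp

lemma loc_run_no_act:
  assumes "t \<le> t'" "\<And>u. t \<le> u \<Longrightarrow> u < t' \<Longrightarrow> s u \<noteq> Act i"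
  shows "loc (run \<pi> x r p s t') i = loc (run \<pi> x r p s t) i"
  using assms
proof (induction t' rule: dec_induct)
  case (step n)
  then show ?case by (auto simp: loc_step_other)
qed simp

section \<open>Fairness: later actions and eventual delivery\<close>

lemma fair_later:
  assumes "fair k s" "e \<in> events k"
  obtains u where "t \<le> u" "s u = e"
  using assms unfolding fair_def INFM_nat_le by blast

lemma fair_first:
  assumes "fair k s" "e \<in> events k"
  obtains u where "t \<le> u" "s u = e" "\<And>v. t \<le> v \<Longrightarrow> v < u \<Longrightarrow> s v \<noteq> e"
proof -
  obtain u0 where u0: "t \<le> u0" "s u0 = e" using fair_later[OF assms] .
  define u where "u = (LEAST u. t \<le> u \<and> s u = e)"
  have "t \<le> u \<and> s u = e" unfolding u_def by (rule LeastI[of _ u0]) (use u0 in simp)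
  moreover have "s v \<noteq> e" if "t \<le> v" "v < u" for v
    using not_less_Least[of v "\<lambda>u. t \<le> u \<and> s u = e"] that unfolding u_def by blast
  ultimately show ?thesis using that by blast
qed

lemma eventually_arrived:
  assumes "fair k s" "Deliver j i \<in> events k" "m \<le> length (sent (run \<pi> x r p s t) j i)"
  shows "\<exists>t'\<ge>t. m \<le> arrived (run \<pi> x r p s t') j i"
  using assms(3)
proof (induction m)
  case 0
  then show ?case by auto
next
  case (Suc m)
  then obtain t1 where t1: "t1 \<ge> t" "m \<le> arrived (run \<pi> x r p s t1) j i" by auto
  obtain u where u: "t1 \<le> u" "s u = Deliver j i" using fair_later[OF assms(1,2)] .
  have "m \<le> arrived (run \<pi> x r p s u) j i"
    using t1(2) arrived_run_mono[OF u(1)] order.trans by blast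
  moreover have "Suc m \<le> length (sent (run \<pi> x r p s u) j i)"
    using Suc.prems prefix_length_le[OF sent_run_mono[of t u]] t1 u(1) by (meson order.trans)
  ultimately have "Suc m \<le> arrived (run \<pi> x r p s (Suc u)) j i"
    by (simp add: u(2))
  then show ?case using t1 u by (meson le_SucI order.trans)
qed

text \<open>The one condition in a player's move that mentions \<open>arrived\<close>: timing can
  affect a local state only here.\<close>

definition can_read :: "protocol \<Rightarrow> (nat \<Rightarrow> bool list) \<Rightarrow> (nat \<Rightarrow> rstring) \<Rightarrow> rstring \<Rightarrow> config \<Rightarrow> nat \<Rightarrow> bool" where
  "can_read \<pi> x r p c i \<longleftrightarrow>
     (\<forall>j\<in>wait \<pi> i (lround c i) (x i) (r i) p (got c i). length (got c i j) < arrived c j i)"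

lemma loc_step_blocked:
  "status c i = Waiting \<Longrightarrow> \<not> can_read \<pi> x r p c i \<Longrightarrow> loc (step \<pi> x r p (Act i) c) i = loc c i"
  by (auto simp: loc_def end_round_def Let_def can_read_def)

lemma loc_step_read:
  "status c i = Waiting \<Longrightarrow> can_read \<pi> x r p c i \<Longrightarrow> loc (step \<pi> x r p (Act i) c) i =
    (Ready, Suc (lround c i), sent c i,
      (\<lambda>j. if j \<in> wait \<pi> i (lround c i) (x i) (r i) p (got c i)
           then got c i j @ [sent c j i ! length (got c i j)] else got c i j))"
  by (auto simp: loc_def end_round_def Let_def can_read_def)

text \<open>Two protocols are compared because the replay exchanges the program of one player. The
  comparison is between single runs with given strings, so it concerns programs, inputs and strings
  rather than laws.\<close>

definition same_player ::
  "protocol \<Rightarrow> (nat \<Rightarrow> bool list) \<Rightarrow> (nat \<Rightarrow> rstring) \<Rightarrow> protocol \<Rightarrow> (nat \<Rightarrow> bool list) \<Rightarrow> (nat \<Rightarrow> rstring) \<Rightarrow> nat \<Rightarrow> bool" where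
  "same_player \<pi> x r \<pi>' x' r' i \<longleftrightarrow> send \<pi> i = send \<pi>' i \<and> decide \<pi> i = decide \<pi>' i \<and>
     wait \<pi> i = wait \<pi>' i \<and> x i = x' i \<and> r i = r' i"

lemma loc_step_start_cong:
  assumes "same_player \<pi> x r \<pi>' x' r' i" "loc c i = loc c' i" "status c i = Ready"
  shows "loc (step \<pi> x r p (Act i) c) i = loc (step \<pi>' x' r' p (Act i) c') i"
  using assms by (auto simp: same_player_def loc_def start_round_def split: option.split)

lemma prefix_nth_eq:
  assumes "prefix a c" "prefix b c" "m < length a" "m < length b"
  shows "a ! m = b ! m"
  using assms by (metis nth_append prefix_def)

text \<open>
  A player blocked in a read resumes exactly when all awaited messages have arrived, whatever
  the order of arrival: this is why the executions are independent of the scheduler. Players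
  outside \<open>S\<close> may follow different programs in the two runs, provided that they send to \<open>S\<close>
  in the second run at least what they send in the first.
\<close>

lemma local_state_recurs:
  fixes k :: nat and S :: "nat set"
  assumes S: "S \<subseteq> {1..k}"
    and fair: "fair k s'" and evs: "range s \<subseteq> events k"
    and same: "\<And>i. i \<in> S \<Longrightarrow> same_player \<pi> x r \<pi>' x' r' i"
    and waits: "\<And>i l y q g w. i \<in> S \<Longrightarrow> l \<ge> 1 \<Longrightarrow> wait \<pi> i l y q w g \<subseteq> others k i"
    and outside: "\<And>i j t. j \<in> {1..k} - S \<Longrightarrow> i \<in> S \<Longrightarrow>
       \<exists>t'. prefix (sent (run \<pi> x r p s t) j i) (sent (run \<pi>' x' r' p s' t') j i)"
    and "i \<in> S"
  shows "\<exists>t'. loc (run \<pi>' x' r' p s' t') i = loc (run \<pi> x r p s t) i"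
  using \<open>i \<in> S\<close>
proof (induction t arbitrary: i)
  case 0
  then show ?case by (auto intro!: exI[of _ 0])
next
  case (Suc t)
  let ?A = "run \<pi> x r p s" and ?B = "run \<pi>' x' r' p s'"
  obtain t0 where t0: "loc (?B t0) i = loc (?A t) i" using Suc by blast
  have act: "Act i \<in> events k" using S Suc.prems by (auto simp: events_def)
  show ?case
  proof (cases "s t = Act i")
    case False
    then show ?thesis using t0 by (auto simp: loc_step_other)
  next
    case True
    show ?thesis
    proof (cases "status (?A t) i")
      case Ready
      obtain u where u: "t0 \<le> u" "s' u = Act i" "\<And>v. t0 \<le> v \<Longrightarrow> v < u \<Longrightarrow> s' v \<noteq> Act i"
        using fair_first[OF fair act] by blast
      have "loc (?B u) i = loc (?A t) i" using loc_run_no_act[OF u(1,3)] t0 by simp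
      then have "loc (?B (Suc u)) i = loc (?A (Suc t)) i"
        using loc_step_start_cong[OF same[OF Suc.prems], of "?A t" "?B u" p] Ready True u(2) by simp
      then show ?thesis by blast
    next
      case (Stopped w)
      then show ?thesis using t0 loc_step_stopped[OF Stopped] by auto
    next
      case Waiting
      show ?thesis
      proof (cases "can_read \<pi> x r p (?A t) i")
        case False
        then show ?thesis using t0 loc_step_blocked[OF Waiting False] True by auto
      next
        case rA: True
        define W where "W = wait \<pi> i (lround (?A t) i) (x i) (r i) p (got (?A t) i)"
        define m where "m j = length (got (?A t) i j)" for j
        have W: "W \<subseteq> others k i" unfolding W_def by (rule waits[OF Suc.prems lround_ge_1])
        have finW: "finite W" by (rule finite_subset[OF W]) (simp add: others_def)
        have mA: "m j < length (sent (?A t) j i)" if "j \<in> W" for j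
        proof -
          have "m j < arrived (?A t) j i" using rA that unfolding can_read_def W_def m_def by blast
          then show ?thesis using arrived_le_sent by (rule order.strict_trans2)
        qed
        have same_i: "same_player \<pi> x r \<pi>' x' r' i" by (rule same[OF Suc.prems])
        have wait_B: "wait \<pi>' i (lround c i) (x' i) (r' i) p (got c i) = W"
          if "loc c i = loc (?A t) i" for c
          using same_i loc_eqD[OF that] by (simp add: W_def same_player_def)
        \<comment> \<open>The induction hypothesis covers all players of \<open>S\<close> at time
          \<open>t\<close>, so it also tells what the senders in \<open>S\<close> have sent.\<close>
        have pre: "\<exists>t'. prefix (sent (?A t) j i) (sent (?B t') j i)" if "j \<in> W" for j
        proof (cases "j \<in> S")
          case True
          then obtain t' where "loc (?B t') j = loc (?A t) j" using Suc.IH by blast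
          then have "sent (?B t') j = sent (?A t) j" by (rule loc_eqD)
          then show ?thesis by (metis prefix_order.order_refl)
        next
          case False
          then show ?thesis using outside[of j i t] W that Suc.prems by (auto simp: others_def)
        qed
        have arr: "\<exists>t'. prefix (sent (?A t) j i) (sent (?B t') j i) \<and> m j < arrived (?B t') j i"
          if j: "j \<in> W" for j
        proof -
          obtain t1 where t1: "prefix (sent (?A t) j i) (sent (?B t1) j i)" using pre[OF j] by blast
          have "Suc (m j) \<le> length (sent (?B t1) j i)"
            using mA[OF j] prefix_length_le[OF t1] by simp
          moreover have "Deliver j i \<in> events k"
            using j W S Suc.prems by (auto simp: events_def others_def)
          ultimately obtain t' where t': "t' \<ge> t1" "Suc (m j) \<le> arrived (?B t') j i"
            using eventually_arrived[OF fair] by blast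
          then show ?thesis
            using prefix_order.trans[OF t1 sent_run_mono[OF t'(1)]] by (auto simp: Suc_le_eq)
        qed
        then obtain T where T: "\<And>j. j \<in> W \<Longrightarrow> prefix (sent (?A t) j i) (sent (?B (T j)) j i)"
          "\<And>j. j \<in> W \<Longrightarrow> m j < arrived (?B (T j)) j i" by metis
        define T1 where "T1 = Max (insert t0 (T ` W))"
        have T1: "t0 \<le> T1" "\<And>j. j \<in> W \<Longrightarrow> T j \<le> T1" using finW by (auto simp: T1_def)
        obtain u0 where u0: "T1 \<le> u0" "s' u0 = Act i" using fair_later[OF fair act] .
        have arr_u0: "m j < arrived (?B u0) j i" and pre_u0: "prefix (sent (?A t) j i) (sent (?B u0) j i)"
          if "j \<in> W" for j
        proof -
          have le: "T j \<le> u0" using T1(2)[OF that] u0(1) by simp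
          show "m j < arrived (?B u0) j i" using T(2)[OF that] arrived_run_mono[OF le] by (rule order.strict_trans2)
          show "prefix (sent (?A t) j i) (sent (?B u0) j i)"
            using T(1)[OF that] sent_run_mono[OF le] by (rule prefix_order.trans)
        qed
        define ok where "ok v \<longleftrightarrow> t0 \<le> v \<and> s' v = Act i \<and> (\<forall>j\<in>W. m j < arrived (?B v) j i)" for v
        have ok_u0: "ok u0" using u0 T1(1) arr_u0 by (simp add: ok_def)
        define u where "u = (LEAST v. ok v)"
        have u: "ok u" unfolding u_def by (rule LeastI[of ok, OF ok_u0])
        have u_le: "u \<le> u0" unfolding u_def by (rule Least_le[of ok, OF ok_u0])
        have not_ok: "\<not> ok v" if "v < u" for v using that not_less_Least unfolding u_def by blast
        have stay: "loc (?B v) i = loc (?A t) i" if "t0 \<le> v" "v \<le> u" for v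
          using that
        proof (induction v rule: dec_induct)
          case base
          show ?case by (rule t0)
        next
          case (step v)
          then have IH: "loc (?B v) i = loc (?A t) i" by simp
          show ?case
          proof (cases "s' v = Act i")
            case True
            have "\<not> can_read \<pi>' x' r' p (?B v) i"
              using not_ok[of v] step True IH loc_eqD[OF IH] wait_B[OF IH]
              by (auto simp: ok_def can_read_def m_def)
            then show ?thesis
              using loc_step_blocked[of "?B v" i] Waiting loc_eqD[OF IH] IH True by simp
          next
            case False
            then show ?thesis using IH by (simp add: loc_step_other)
          qed
        qed
        have tu: "t0 \<le> u" "s' u = Act i" "\<And>j. j \<in> W \<Longrightarrow> m j < arrived (?B u) j i"
          using u by (auto simp: ok_def)
        have locu: "loc (?B u) i = loc (?A t) i" by (rule stay[OF tu(1) order_refl])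
        have rB: "can_read \<pi>' x' r' p (?B u) i"
          using tu(3) loc_eqD[OF locu] wait_B[OF locu] by (auto simp: can_read_def m_def)
        have wB: "status (?B u) i = Waiting" using Waiting loc_eqD[OF locu] by simp
        \<comment> \<open>\<open>u\<close> may precede the times \<open>T j\<close>, so the two
          message sequences are compared through \<open>u0\<close>: both are prefixes of what has
          been sent by then.\<close>
        have nth: "sent (?B u) j i ! m j = sent (?A t) j i ! m j" if "j \<in> W" for j
          using sent_run_mono[OF u_le] pre_u0[OF that]
          by (rule prefix_nth_eq)
            (use mA[OF that] tu(3)[OF that] arrived_le_sent[of \<pi>' x' r' p s' u j i] in auto)
        have "loc (?B (Suc u)) i = loc (?A (Suc t)) i"
          using loc_step_read[OF wB rB] loc_step_read[OF Waiting rA] nth wait_B[OF locu] loc_eqD[OF locu]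
          by (auto simp: tu(2) True W_def[symmetric] m_def intro!: ext)
        then show ?thesis by blast
      qed
    qed
  qed
qed

section \<open>Replaying a transcript\<close>

text \<open>The local state of a stopped player is frozen. This turns the mere recurrence of a local
  state in another run into equality of the final states.\<close>

lemma stopped_loc_unique:
  assumes "stopped (run \<pi> x r p s t) i" "stopped (run \<pi> x r p s t') i"
  shows "loc (run \<pi> x r p s t) i = loc (run \<pi> x r p s t') i"
  using assms loc_run_stopped[of t t'] loc_run_stopped[of t' t] nat_le_linear[of t t']
  by (metis stopped_def)

lemma stopped_run_mono: "stopped (run \<pi> x r p s t) i \<Longrightarrow> t \<le> t' \<Longrightarrow> stopped (run \<pi> x r p s t') i"
  by (metis stopped_def loc_run_stopped loc_eqD(1))

lemma stopped_final:
  assumes "\<forall>i\<in>{1..k}. \<exists>t. stopped (run \<pi> x r p (\<sigma> x r p) t) i" "i \<in> {1..k}"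
  shows "stopped (final k \<pi> \<sigma> x r p) i"
proof -
  obtain T where T: "\<And>i. i \<in> {1..k} \<Longrightarrow> stopped (run \<pi> x r p (\<sigma> x r p) (T i)) i"
    using assms(1) by metis
  have "T i \<le> Max (T ` {1..k})" if "i \<in> {1..k}" for i using that by simp
  then have "\<forall>i\<in>{1..k}. stopped (run \<pi> x r p (\<sigma> x r p) (Max (T ` {1..k}))) i"
    using T stopped_run_mono by blast
  then have "\<forall>i\<in>{1..k}. stopped (final k \<pi> \<sigma> x r p) i"
    unfolding final_def by (rule LeastI)
  then show ?thesis using assms(2) by blast
qed

lemma is_protocol_wait: "is_protocol k \<pi> \<Longrightarrow> i \<in> {1..k} \<Longrightarrow> 1 \<le> l \<Longrightarrow> wait \<pi> i l y q w g \<subseteq> others k i"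
  unfolding is_protocol_def by blast

text \<open>With \<open>S = {1..k}\<close> no player is outside \<open>S\<close>. Halting under
  \<sigma> suffices, because the stopped states recur under \<sigma>' and are final there
  too.\<close>

lemma final_loc_scheduler_independent:
  assumes "is_protocol k \<pi>" "fair k (\<sigma> x r p)" "fair k (\<sigma>' x r p)"
    and stop: "\<forall>i\<in>{1..k}. \<exists>t. stopped (run \<pi> x r p (\<sigma> x r p) t) i"
    and i: "i \<in> {1..k}"
  shows "loc (final k \<pi> \<sigma>' x r p) i = loc (final k \<pi> \<sigma> x r p) i"
proof -
  have ex: "\<exists>t'. loc (run \<pi> x r p (\<sigma>' x r p) t') i = loc (run \<pi> x r p (\<sigma> x r p) t) i"
    if "i \<in> {1..k}" for i t
    by (rule local_state_recurs[of "{1..k}" k])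
      (use assms that is_protocol_wait in \<open>auto simp: same_player_def fair_def\<close>)
  have stop': "\<forall>i\<in>{1..k}. \<exists>t. stopped (run \<pi> x r p (\<sigma>' x r p) t) i"
    using stop ex loc_eqD(1) unfolding stopped_def by metis
  obtain t' where t': "loc (run \<pi> x r p (\<sigma>' x r p) t') i = loc (final k \<pi> \<sigma> x r p) i"
    using ex[OF i] unfolding final_def by blast
  have "stopped (run \<pi> x r p (\<sigma>' x r p) t') i"
    using stopped_final[of k \<pi> x r p \<sigma>, OF stop i] loc_eqD(1)[OF t'] by (simp add: stopped_def)
  then show ?thesis
    using stopped_loc_unique[of \<pi> x r p "\<sigma>' x r p" t' i] stopped_final[of k \<pi> x r p \<sigma>', OF stop' i] t'
    unfolding final_def by metis
qed

text \<open>The script uses only the order of the messages on each link, which is all that the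
  recorded \<open>sent\<close> sequences retain. In round \<open>l\<close> each recipient gets its
  \<open>l\<close>-th message; the index is \<open>l - 1\<close> as rounds start at 1. Never waiting
  and never stopping, the scripted player sends everything sooner or later without consulting any
  input or random string.\<close>

definition scripted :: "nat \<Rightarrow> nat \<Rightarrow> (nat \<Rightarrow> msg list) \<Rightarrow> protocol \<Rightarrow> protocol" where
  "scripted k i T \<pi> = \<pi>\<lparr>
     send := (send \<pi>)(i := \<lambda>l x r p g j.
       if j \<in> others k i \<and> l \<le> length (T j) then Some (T j ! (l - 1)) else None),
     decide := (decide \<pi>)(i := \<lambda>_ _ _ _ _. None),
     wait := (wait \<pi>)(i := \<lambda>_ _ _ _ _. {})\<rparr>"

lemma scripted_simps [simp]:
  "j \<noteq> i \<Longrightarrow> send (scripted k i T \<pi>) j = send \<pi> j"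
  "j \<noteq> i \<Longrightarrow> decide (scripted k i T \<pi>) j = decide \<pi> j"
  "j \<noteq> i \<Longrightarrow> wait (scripted k i T \<pi>) j = wait \<pi> j"
  "send (scripted k i T \<pi>) i = (\<lambda>l x r p g j.
       if j \<in> others k i \<and> l \<le> length (T j) then Some (T j ! (l - 1)) else None)"
  "decide (scripted k i T \<pi>) i = (\<lambda>_ _ _ _ _. None)"
  "wait (scripted k i T \<pi>) i = (\<lambda>_ _ _ _ _. {})"
  "priv_law (scripted k i T \<pi>) = priv_law \<pi>"
  "pub_law (scripted k i T \<pi>) = pub_law \<pi>"
  by (simp_all add: scripted_def)

text \<open>Makes the measurability results on executions applicable to the replay.\<close>

lemma is_protocol_scripted:
  assumes "is_protocol k \<pi>"
  shows "is_protocol k (scripted k i T \<pi>)"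
  unfolding is_protocol_def
proof (intro conjI ballI allI impI)
  fix j l x g
  assume j: "j \<in> {1..k}" and l: "1 \<le> (l::nat)"
  note P = assms[unfolded is_protocol_def]
  show "send (scripted k i T \<pi>) j l x r p g j' \<noteq> None \<Longrightarrow> j' \<in> others k j" for r p j'
    using P j l by (cases "j = i") (auto split: if_splits)
  show "wait (scripted k i T \<pi>) j l x r p g \<subseteq> others k j" for r p
    using P j l by (cases "j = i") simp_all
  show "(\<lambda>(r, p). send (scripted k i T \<pi>) j l x r p g j') \<in> rspace \<Otimes>\<^sub>M rspace \<rightarrow>\<^sub>M count_space UNIV" for j'
    using P j l by (cases "j = i") simp_all
  show "(\<lambda>(r, p). decide (scripted k i T \<pi>) j l x r p g) \<in> rspace \<Otimes>\<^sub>M rspace \<rightarrow>\<^sub>M count_space UNIV"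
    using P j l by (cases "j = i") simp_all
  show "(\<lambda>(r, p). j' \<in> wait (scripted k i T \<pi>) j l x r p g) \<in> rspace \<Otimes>\<^sub>M rspace \<rightarrow>\<^sub>M count_space UNIV" for j'
    using P j l by (cases "j = i") simp_all
qed (use assms in \<open>auto simp: is_protocol_def\<close>)

text \<open>A player that is \<open>Ready\<close> has not yet sent the messages of round
  \<open>lround\<close>, hence the \<open>- 1\<close>.\<close>

definition rounds_sent :: "config \<Rightarrow> nat \<Rightarrow> nat" where
  "rounds_sent c i = (if status c i = Ready then lround c i - 1 else lround c i)"

lemma scripted_invariant:
  fixes \<pi> k i T x r p s t
  defines "c \<equiv> run (scripted k i T \<pi>) x r p s t"
  shows "status c i \<in> {Ready, Waiting}"
    and "j \<in> others k i \<Longrightarrow> sent c i j = take (rounds_sent c i) (T j)"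
  unfolding c_def
proof (induction t)
  case 0
  show "status (run (scripted k i T \<pi>) x r p s 0) i \<in> {Ready, Waiting}" by (simp add: init_def)
  show "sent (run (scripted k i T \<pi>) x r p s 0) i j =
    take (rounds_sent (run (scripted k i T \<pi>) x r p s 0) i) (T j)" by (simp add: init_def rounds_sent_def)
next
  case (Suc t)
  let ?c = "run (scripted k i T \<pi>) x r p s t"
  have l: "1 \<le> lround ?c i" by (rule lround_ge_1)
  show st: "status (run (scripted k i T \<pi>) x r p s (Suc t)) i \<in> {Ready, Waiting}"
  proof (cases "s t = Act i")
    case True
    then show ?thesis using Suc by (auto simp: start_round_def end_round_def Let_def)
  next
    case False
    then have "loc (run (scripted k i T \<pi>) x r p s (Suc t)) i = loc ?c i"
      by (simp add: loc_step_other)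
    from loc_eqD(1)[OF this] show ?thesis using Suc(1) by simp
  qed
  assume j: "j \<in> others k i"
  note IH = Suc(2)[OF j]
  show "sent (run (scripted k i T \<pi>) x r p s (Suc t)) i j =
    take (rounds_sent (run (scripted k i T \<pi>) x r p s (Suc t)) i) (T j)"
  proof (cases "s t = Act i")
    case True
    show ?thesis
    proof (cases "status ?c i = Ready")
      case R: True
      have [simp]: "take (lround ?c i) (T j) = take (lround ?c i - 1) (T j) @ [T j ! (lround ?c i - 1)]"
        if "lround ?c i \<le> length (T j)"
        using l that take_Suc_conv_app_nth[of "lround ?c i - 1" "T j"] by simp
      show ?thesis using IH True R j by (auto simp: rounds_sent_def start_round_def)
    next
      case False
      then show ?thesis using IH True Suc(1) by (auto simp: rounds_sent_def end_round_def Let_def)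
    qed
  next
    case False
    then have "loc (run (scripted k i T \<pi>) x r p s (Suc t)) i = loc ?c i"
      by (simp add: loc_step_other)
    from loc_eqD[OF this] show ?thesis using IH by (simp add: rounds_sent_def)
  qed
qed

lemma scripted_progress:
  assumes "fair k s" "i \<in> {1..k}"
  shows "\<exists>t. m \<le> rounds_sent (run (scripted k i T \<pi>) x r p s t) i"
proof -
  let ?c = "run (scripted k i T \<pi>) x r p s"
  \<comment> \<open>\<open>h\<close> counts half rounds. Every \<open>Act i\<close> raises it by
    exactly one, since a player that awaits nobody is never blocked.\<close>
  define h where "h c = 2 * lround c i + (if status c i = Waiting then 1 else 0)" for c :: config
  have act: "Act i \<in> events k" using assms(2) by (auto simp: events_def)
  have "\<exists>t. n \<le> h (?c t)" for n
  proof (induction n)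
    case (Suc n)
    then obtain t where t: "n \<le> h (?c t)" by blast
    obtain u where u: "t \<le> u" "s u = Act i" "\<And>v. t \<le> v \<Longrightarrow> v < u \<Longrightarrow> s v \<noteq> Act i"
      using fair_first[OF assms(1) act] by blast
    have "h (?c u) = h (?c t)"
      using loc_eqD[OF loc_run_no_act[OF u(1,3)]] by (simp add: h_def)
    moreover have "h (?c (Suc u)) = Suc (h (?c u))"
      using scripted_invariant(1)[of k i T \<pi> x r p s u]
      by (auto simp: u(2) h_def start_round_def end_round_def Let_def)
    ultimately show ?case using t by (intro exI[of _ "Suc u"]) simp
  qed simp
  then obtain t where "2 * Suc m + 1 \<le> h (?c t)" by blast
  then have "m \<le> rounds_sent (?c t) i" by (auto simp: h_def rounds_sent_def split: if_splits)
  then show ?thesis by blast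
qed

text \<open>Replaces \<open>final\<close> in replays: the scripted player never stops, so there is
  no time at which all players have stopped.\<close>

definition run_output :: "protocol \<Rightarrow> (nat \<Rightarrow> bool list) \<Rightarrow> (nat \<Rightarrow> rstring) \<Rightarrow> rstring \<Rightarrow> (nat \<Rightarrow> event) \<Rightarrow> nat \<Rightarrow> status" where
  "run_output \<pi> x r p s i = status (run \<pi> x r p s (LEAST t. stopped (run \<pi> x r p s t) i)) i"

lemma run_output_eq:
  assumes "status (run \<pi> x r p s t) i = Stopped w"
  shows "run_output \<pi> x r p s i = Stopped w"
proof -
  have st: "stopped (run \<pi> x r p s t) i" using assms by (simp add: stopped_def)
  have "stopped (run \<pi> x r p s (LEAST t. stopped (run \<pi> x r p s t) i)) i"
    by (rule LeastI) (rule st)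
  from stopped_loc_unique[OF this st] show ?thesis
    unfolding run_output_def using assms loc_eqD(1) by metis
qed

text \<open>Recurrence with \<open>S = others k i\<close>. The only player outside is
  \<open>i\<close>, and its script eventually contains whatever it had sent at any time of the
  original run. Nothing is assumed on \<open>x' i\<close> and \<open>r' i\<close>, so the output of
  \<open>m\<close> is a function of \<open>T\<close>, the public string and the data of the other
  players.\<close>

lemma scripted_output:
  assumes prot: "is_protocol k \<pi>" and fair: "fair k s"
    and stop: "\<forall>i\<in>{1..k}. \<exists>t. stopped (run \<pi> x r p s t) i"
    and i: "i \<in> {1..k}" and m: "m \<in> others k i"
    and T: "\<And>j. j \<in> others k i \<Longrightarrow> T j = sent (final k \<pi> (\<lambda>_ _ _. s) x r p) i j"
    and agree: "\<And>j. j \<in> others k i \<Longrightarrow> x' j = x j \<and> r' j = r j"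
  shows "run_output (scripted k i T \<pi>) x' r' p s m = status (final k \<pi> (\<lambda>_ _ _. s) x r p) m"
proof -
  define tf where "tf = (LEAST t. \<forall>i\<in>{1..k}. stopped (run \<pi> x r p s t) i)"
  have final: "final k \<pi> (\<lambda>_ _ _. s) x r p = run \<pi> x r p s tf"
    by (simp add: final_def tf_def)
  have st: "stopped (run \<pi> x r p s tf) j" if "j \<in> {1..k}" for j
    using stopped_final[of k \<pi> x r p "\<lambda>_ _ _. s", OF stop that] by (simp add: final)
  have pre: "prefix (sent (run \<pi> x r p s t) i j) (T j)" if j: "j \<in> others k i" for t j
  proof (cases "t \<le> tf")
    case True
    then show ?thesis using sent_run_mono T[OF j] final by metis
  next
    case False
    then have "loc (run \<pi> x r p s t) i = loc (run \<pi> x r p s tf) i"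
      using st[OF i] loc_run_stopped unfolding stopped_def by (metis nat_le_linear)
    from loc_eqD(3)[OF this] show ?thesis using T[OF j] final by simp
  qed
  have all: "\<exists>t'. sent (run (scripted k i T \<pi>) x' r' p s t') i j = T j" if j: "j \<in> others k i" for j
  proof -
    obtain t' where "length (T j) \<le> rounds_sent (run (scripted k i T \<pi>) x' r' p s t') i"
      using scripted_progress[OF fair i] by blast
    then show ?thesis using scripted_invariant(2)[OF j] by (metis take_all)
  qed
  have "\<exists>t'. loc (run (scripted k i T \<pi>) x' r' p s t') m = loc (run \<pi> x r p s tf) m"
  proof (rule local_state_recurs[of "others k i" k])
    show "others k i \<subseteq> {1..k}" by (auto simp: others_def)
    show "range s \<subseteq> events k" using fair by (simp add: fair_def)
    show "same_player \<pi> x r (scripted k i T \<pi>) x' r' j" if "j \<in> others k i" for j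
      using that agree[OF that] by (auto simp: same_player_def others_def)
    show "wait \<pi> j l y q w g \<subseteq> others k j" if "j \<in> others k i" "1 \<le> l" for j l y q w g
      using that prot by (intro is_protocol_wait) (auto simp: others_def)
    show "\<exists>t'. prefix (sent (run \<pi> x r p s t) a j) (sent (run (scripted k i T \<pi>) x' r' p s t') a j)"
      if "a \<in> {1..k} - others k i" "j \<in> others k i" for a j t
    proof -
      have "a = i" using that(1) by (auto simp: others_def)
      then show ?thesis using pre[OF that(2)] all[OF that(2)] by metis
    qed
  qed (use fair m in auto)
  then obtain t' where t': "loc (run (scripted k i T \<pi>) x' r' p s t') m = loc (run \<pi> x r p s tf) m"
    by blast
  obtain w where w: "status (run \<pi> x r p s tf) m = Stopped w"
    using st[of m] m by (auto simp: stopped_def others_def)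
  then show ?thesis using run_output_eq loc_eqD(1)[OF t'] final by metis
qed

section \<open>Measurability of executions\<close>

text \<open>Configurations contain functions on all of \<open>nat\<close> and form an uncountable
  type, but a run reaches only countably many of them at any given time. Countable range together
  with measurable fibres gives measurability into the discrete space and is preserved along a
  run.\<close>

definition countably_valued :: "'a measure \<Rightarrow> ('a \<Rightarrow> 'b) \<Rightarrow> bool" where
  "countably_valued M f \<longleftrightarrow> countable (f ` space M) \<and> (\<forall>c. {\<omega>\<in>space M. f \<omega> = c} \<in> sets M)"

lemma countably_valued_measurable:
  assumes "countably_valued M f"
  shows "f \<in> M \<rightarrow>\<^sub>M count_space UNIV"
proof (rule measurableI)
  fix A :: "'b set"
  have "f -` A \<inter> space M = (\<Union>c\<in>A \<inter> f ` space M. {\<omega>\<in>space M. f \<omega> = c})" by auto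
  also have "\<dots> \<in> sets M"
    using assms unfolding countably_valued_def by (intro sets.countable_UN') auto
  finally show "f -` A \<inter> space M \<in> sets M" .
qed simp

lemma measurable_countably_valued:
  assumes "f \<in> M \<rightarrow>\<^sub>M count_space UNIV" "countable (f ` space M)"
  shows "countably_valued M f"
proof -
  have "{\<omega>\<in>space M. f \<omega> = c} = f -` {c} \<inter> space M" for c by auto
  then show ?thesis using assms measurable_sets[OF assms(1)] by (simp add: countably_valued_def)
qed

lemma measurable_countable_type_countably_valued:
  fixes f :: "'a \<Rightarrow> 'b::countable"
  shows "f \<in> M \<rightarrow>\<^sub>M count_space UNIV \<Longrightarrow> countably_valued M f"
  by (rule measurable_countably_valued) auto

lemma countably_valued_const: "countably_valued M (\<lambda>_. c)"
  by (auto simp: countably_valued_def image_constant_conv)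

text \<open>A case distinction over the countably many values of \<open>g\<close>. It lets one step
  of a run be studied from a constant configuration although the actual one is random.\<close>

lemma countably_valued_bind:
  assumes g: "countably_valued M g" and F: "\<And>c. c \<in> g ` space M \<Longrightarrow> countably_valued M (F c)"
  shows "countably_valued M (\<lambda>\<omega>. F (g \<omega>) \<omega>)"
  unfolding countably_valued_def
proof (intro conjI allI)
  have "(\<lambda>\<omega>. F (g \<omega>) \<omega>) ` space M \<subseteq> (\<Union>c\<in>g ` space M. F c ` space M)" by auto
  then show "countable ((\<lambda>\<omega>. F (g \<omega>) \<omega>) ` space M)"
    by (rule countable_subset, intro countable_UN)
      (use assms in \<open>auto simp only: countably_valued_def\<close>)
  fix d
  have "{\<omega>\<in>space M. F (g \<omega>) \<omega> = d} =
    (\<Union>c\<in>g ` space M. {\<omega>\<in>space M. g \<omega> = c} \<inter> {\<omega>\<in>space M. F c \<omega> = d})" by auto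
  also have "\<dots> \<in> sets M"
    using assms unfolding countably_valued_def by (intro sets.countable_UN') auto
  finally show "{\<omega>\<in>space M. F (g \<omega>) \<omega> = d} \<in> sets M" .
qed

lemma countably_valued_compose: "countably_valued M g \<Longrightarrow> countably_valued M (\<lambda>\<omega>. h (g \<omega>))"
  by (rule countably_valued_bind[where F = "\<lambda>c _. h c"]) (auto intro: countably_valued_const)

lemma countably_valued_compose2:
  "countably_valued M f \<Longrightarrow> countably_valued M g \<Longrightarrow> countably_valued M (\<lambda>\<omega>. h (f \<omega>) (g \<omega>))"
  by (rule countably_valued_bind[where F = "\<lambda>c \<omega>. h c (g \<omega>)"]) (auto intro: countably_valued_compose)

text \<open>The functions that occur differ from a constant one only on the finite set
  \<open>F\<close>; this keeps their number countable.\<close>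

lemma countably_valued_fun:
  assumes "finite F" "\<And>j. j \<in> F \<Longrightarrow> countably_valued M (h j)" "\<And>j \<omega>. \<omega> \<in> space M \<Longrightarrow> j \<notin> F \<Longrightarrow> h j \<omega> = d"
  shows "countably_valued M (\<lambda>\<omega> j. h j \<omega>)"
proof -
  have "countably_valued M (\<lambda>\<omega> j. if j \<in> F then h j \<omega> else d)"
    using assms(1,2)
  proof (induction F)
    case empty
    then show ?case by (simp add: countably_valued_const)
  next
    case (insert a F)
    have eq: "(\<lambda>j. if j \<in> insert a F then h j \<omega> else d) = (\<lambda>j. if j \<in> F then h j \<omega> else d)(a := h a \<omega>)" for \<omega>
      using insert.hyps by auto
    show ?case unfolding eq
      by (rule countably_valued_compose2[where h = "\<lambda>f b. f(a := b)"]) (use insert in auto)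
  qed
  moreover have "(\<lambda>j. if j \<in> F then h j \<omega> else d) = (\<lambda>j. h j \<omega>)" if "\<omega> \<in> space M" for \<omega>
    using assms(3)[OF that] by auto
  ultimately show ?thesis
    unfolding countably_valued_def by (simp cong: image_cong conj_cong)
qed

lemma countably_valued_Least:
  fixes P :: "nat \<Rightarrow> 'a \<Rightarrow> bool"
  assumes "\<And>t. countably_valued M (P t)"
  shows "countably_valued M (\<lambda>\<omega>. LEAST t. P t \<omega>)"
  by (rule measurable_countable_type_countably_valued, rule measurable_Least)
    (rule countably_valued_measurable[OF assms])

text \<open>The probability space is abstract because there are two instances: the joint law of
  inputs and strings, and the space of what the guesser sees, where the string of player
  \<open>i\<close> is a constant.\<close>

locale random_strings =
  fixes k :: nat and \<pi> :: protocol and M :: "'a measure"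
    and R :: "'a \<Rightarrow> nat \<Rightarrow> rstring" and Rp :: "'a \<Rightarrow> rstring"
  assumes protocol: "is_protocol k \<pi>"
    and R_measurable: "i \<in> {1..k} \<Longrightarrow> (\<lambda>\<omega>. R \<omega> i) \<in> M \<rightarrow>\<^sub>M rspace"
    and Rp_measurable: "Rp \<in> M \<rightarrow>\<^sub>M rspace"
begin

lemma pair_measurable:
  assumes "i \<in> {1..k}" "(\<lambda>(r, p). f r p) \<in> rspace \<Otimes>\<^sub>M rspace \<rightarrow>\<^sub>M N"
  shows "(\<lambda>\<omega>. f (R \<omega> i) (Rp \<omega>)) \<in> M \<rightarrow>\<^sub>M N"
  using measurable_compose[OF measurable_Pair[OF R_measurable[OF assms(1)] Rp_measurable] assms(2)] by simp

lemma countably_valued_step: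
  assumes e: "e \<in> events k" and l: "\<And>i. 1 \<le> lround c i"
  shows "countably_valued M (\<lambda>\<omega>. step \<pi> x (R \<omega>) (Rp \<omega>) e c)"
proof (cases e)
  case (Deliver i j)
  then show ?thesis by (simp add: countably_valued_const)
next
  case (Act i)
  have i: "i \<in> {1..k}" using e Act by (auto simp: events_def)
  note P = protocol[unfolded is_protocol_def]
  have fin: "finite (others k i)" by (simp add: others_def)
  let ?l = "lround c i" and ?g = "got c i"
  have 1: "countably_valued M (\<lambda>\<omega> j. send \<pi> i ?l (x i) (R \<omega> i) (Rp \<omega>) ?g j)"
    using fin
  proof (rule countably_valued_fun)
    show "countably_valued M (\<lambda>\<omega>. send \<pi> i ?l (x i) (R \<omega> i) (Rp \<omega>) ?g j)" for j
      by (rule measurable_countable_type_countably_valued, rule pair_measurable[OF i])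
        (use P i l in blast)
    show "send \<pi> i ?l (x i) (R \<omega> i) (Rp \<omega>) ?g j = None" if "j \<notin> others k i" for j \<omega>
      using P i l that by blast
  qed
  have 2: "countably_valued M (\<lambda>\<omega>. decide \<pi> i ?l (x i) (R \<omega> i) (Rp \<omega>) ?g)"
    by (rule measurable_countable_type_countably_valued, rule pair_measurable[OF i])
      (use P i l in blast)
  have 3: "countably_valued M (\<lambda>\<omega> j. j \<in> wait \<pi> i ?l (x i) (R \<omega> i) (Rp \<omega>) ?g)"
    using fin
  proof (rule countably_valued_fun)
    show "countably_valued M (\<lambda>\<omega>. j \<in> wait \<pi> i ?l (x i) (R \<omega> i) (Rp \<omega>) ?g)" for j
      by (rule measurable_countable_type_countably_valued, rule pair_measurable[OF i])
        (use P i l in blast)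
    show "(j \<in> wait \<pi> i ?l (x i) (R \<omega> i) (Rp \<omega>) ?g) = False" if "j \<notin> others k i" for j \<omega>
      using P i l that by blast
  qed
  show ?thesis
  proof (cases "status c i")
    case Ready
    have "countably_valued M (\<lambda>\<omega>. (\<lambda>f d. c\<lparr>
       sent := (sent c)(i := \<lambda>j. case f j of None \<Rightarrow> sent c i j | Some m \<Rightarrow> sent c i j @ [m]),
       status := (status c)(i := case d of None \<Rightarrow> Waiting | Some w \<Rightarrow> Stopped w)\<rparr>)
      (\<lambda>j. send \<pi> i ?l (x i) (R \<omega> i) (Rp \<omega>) ?g j) (decide \<pi> i ?l (x i) (R \<omega> i) (Rp \<omega>) ?g))"
      using 1 2 by (rule countably_valued_compose2)
    then show ?thesis by (simp add: Act Ready start_round_def)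
  next
    case Waiting
    have "countably_valued M (\<lambda>\<omega>. (\<lambda>W. if \<forall>j. W j \<longrightarrow> length (got c i j) < arrived c j i
      then c\<lparr>got := (got c)(i := \<lambda>j.
               if W j then got c i j @ [sent c j i ! length (got c i j)] else got c i j),
             status := (status c)(i := Ready),
             lround := (lround c)(i := Suc (lround c i))\<rparr>
      else c) (\<lambda>j. j \<in> wait \<pi> i ?l (x i) (R \<omega> i) (Rp \<omega>) ?g))"
      using 3 by (rule countably_valued_compose)
    then show ?thesis by (simp add: Act Waiting end_round_def Let_def Ball_def)
  next
    case Stopped
    then show ?thesis by (simp add: Act countably_valued_const)
  qed
qed

lemma countably_valued_run:
  assumes "range s \<subseteq> events k"
  shows "countably_valued M (\<lambda>\<omega>. run \<pi> x (R \<omega>) (Rp \<omega>) s t)"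
proof (induction t)
  case 0
  then show ?case by (simp add: countably_valued_const)
next
  case (Suc t)
  have "countably_valued M (\<lambda>\<omega>. step \<pi> x (R \<omega>) (Rp \<omega>) (s t) (run \<pi> x (R \<omega>) (Rp \<omega>) s t))"
  proof (rule countably_valued_bind[OF Suc, where F = "\<lambda>c \<omega>. step \<pi> x (R \<omega>) (Rp \<omega>) (s t) c"])
    \<comment> \<open>\<open>is_protocol\<close> speaks of rounds from 1 on, so \<open>c\<close> has
      to be a configuration that the run actually reaches.\<close>
    fix c assume "c \<in> (\<lambda>\<omega>. run \<pi> x (R \<omega>) (Rp \<omega>) s t) ` space M"
    then have "\<And>i. 1 \<le> lround c i" using lround_ge_1 by blast
    then show "countably_valued M (\<lambda>\<omega>. step \<pi> x (R \<omega>) (Rp \<omega>) (s t) c)"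
      using assms by (intro countably_valued_step) auto
  qed
  then show ?case by simp
qed

lemma countably_valued_final:
  assumes "range s \<subseteq> events k"
  shows "countably_valued M (\<lambda>\<omega>. final k \<pi> (\<lambda>_ _ _. s) x (R \<omega>) (Rp \<omega>))"
  unfolding final_def
  by (rule countably_valued_bind[where F = "\<lambda>t \<omega>. run \<pi> x (R \<omega>) (Rp \<omega>) s t"], rule countably_valued_Least)
    (auto intro: countably_valued_compose[OF countably_valued_run[OF assms]] countably_valued_run[OF assms])

lemma countably_valued_run_output:
  assumes "range s \<subseteq> events k"
  shows "countably_valued M (\<lambda>\<omega>. run_output \<pi> x (R \<omega>) (Rp \<omega>) s i)"
  unfolding run_output_def
  by (rule countably_valued_bind[where F = "\<lambda>t \<omega>. status (run \<pi> x (R \<omega>) (Rp \<omega>) s t) i"], rule countably_valued_Least)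
    (auto intro: countably_valued_compose[OF countably_valued_run[OF assms]])

end

section \<open>Mutual information from guessing\<close>

text \<open>One half of the Donsker-Varadhan formula; \<open>KL_divergence 2 Q P\<close> is the
  divergence of \<open>P\<close> from \<open>Q\<close>. Bochner integrals of non-integrable
  functions are 0, so integrability has to be secured: domination by \<open>K\<close> bounds the
  density, and \<open>a\<close>, \<open>b\<close> bound the logarithm of \<open>f\<close>.\<close>

lemma KL_divergence_ge_integral_log:
  fixes f :: "'a \<Rightarrow> real"
  assumes Q: "prob_space Q" and P: "prob_space P" and sets: "sets P = sets Q"
    and dom: "\<And>A. A \<in> sets Q \<Longrightarrow> measure P A \<le> K * measure Q A"
    and f: "f \<in> borel_measurable Q" "0 < a" "\<And>x. a \<le> f x" "\<And>x. f x \<le> b"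
    and int1: "(\<integral>x. f x \<partial>Q) \<le> 1"
  shows "(\<integral>x. log 2 (f x) \<partial>P) \<le> KL_divergence 2 Q P"
proof -
  interpret Q: prob_space Q by fact
  interpret P: prob_space P by fact
  note [measurable] = f(1)
  have K: "0 \<le> K"
    using dom[OF sets.top] P.prob_space[unfolded sets_eq_imp_space_eq[OF sets]] by (simp add: Q.prob_space)
  have ac: "absolutely_continuous Q P"
    unfolding absolutely_continuous_def
  proof
    fix A assume "A \<in> null_sets Q"
    then have "A \<in> sets Q" "measure Q A = 0" by (auto simp: Q.emeasure_eq_measure null_sets_def)
    then show "A \<in> null_sets P"
      using dom[of A] measure_nonneg[of P A] by (auto simp: P.emeasure_eq_measure null_sets_def sets)
  qed
  have "finite_measure P" by unfold_locales
  from Q.real_RN_deriv[OF this ac sets] obtain D where D: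
    "D \<in> borel_measurable Q" "AE x in Q. RN_deriv Q P x = ennreal (D x)" "\<And>x. 0 \<le> D x"
    by metis
  note [measurable] = D(1)
  have P_eq: "P = density Q D"
    using Q.density_RN_deriv[OF ac sets] density_cong[OF _ _ D(2)] by simp
  \<comment> \<open>On the set where the density is at least \<open>K + 1\<close>, \<open>P\<close>
    has mass at least \<open>K + 1\<close> times and at most \<open>K\<close> times that of
    \<open>Q\<close>. The gap of 1 makes this set null at once, without a limit.\<close>
  have bound: "AE x in Q. D x \<le> K + 1"
  proof (rule AE_I)
    define A where "A = {x\<in>space Q. K + 1 \<le> D x}"
    have A[measurable]: "A \<in> sets Q" unfolding A_def by measurable
    have "ennreal ((K + 1) * measure Q A) = (\<integral>\<^sup>+x. ennreal (K + 1) * indicator A x \<partial>Q)"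
      using K by (simp add: nn_integral_cmult_indicator Q.emeasure_eq_measure ennreal_mult)
    also have "\<dots> \<le> (\<integral>\<^sup>+x. ennreal (D x) * indicator A x \<partial>Q)"
      by (intro nn_integral_mono) (auto simp: A_def indicator_def intro: ennreal_leI)
    also have "\<dots> = emeasure P A" by (simp add: P_eq emeasure_density)
    also have "\<dots> \<le> ennreal (K * measure Q A)"
      using dom[OF A] by (simp add: P.emeasure_eq_measure ennreal_leI)
    finally have "measure Q A = 0" using K by (simp add: ennreal_le_iff algebra_simps measure_le_0_iff)
    then show "emeasure Q A = 0" by (simp add: Q.emeasure_eq_measure)
    show "A \<in> sets Q" by (rule A)
    show "{x \<in> space Q. \<not> D x \<le> K + 1} \<subseteq> A" by (auto simp: A_def)
  qed
  have logf: "\<bar>log 2 (f x)\<bar> \<le> \<bar>log 2 a\<bar> + \<bar>log 2 b\<bar>" for x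
  proof -
    have "log 2 a \<le> log 2 (f x)" "log 2 (f x) \<le> log 2 b"
      using f(2) f(3,4)[of x] by (auto intro!: Transcendental.log_mono)
    then show ?thesis by linarith
  qed
  have f_pos: "0 < f x" for x using f(2) f(3)[of x] by simp
  have int_f: "integrable Q f"
    by (rule Q.integrable_const_bound[where B = b])
      (use f f_pos in \<open>auto intro!: AE_I2 simp: less_imp_le\<close>)
  have P1: "integrable Q D" "(\<integral>x. D x \<partial>Q) = 1"
  proof -
    show "integrable Q D"
      by (rule Q.integrable_const_bound[where B = "K + 1"]) (use bound D(3) in \<open>auto elim: AE_mp\<close>)
    have "(\<integral>\<^sup>+x. ennreal (D x) \<partial>Q) = 1"
      using P.emeasure_space_1 by (simp add: P_eq emeasure_density cong: nn_integral_cong)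
    then show "(\<integral>x. D x \<partial>Q) = 1" using D(3) by (simp add: integral_eq_nn_integral)
  qed
  have int_Dlogf: "integrable Q (\<lambda>x. D x * log 2 (f x))"
  proof (rule Q.integrable_const_bound[where B = "(K + 1) * (\<bar>log 2 a\<bar> + \<bar>log 2 b\<bar>)"])
    show "AE x in Q. norm (D x * log 2 (f x)) \<le> (K + 1) * (\<bar>log 2 a\<bar> + \<bar>log 2 b\<bar>)"
      using bound
    proof eventually_elim
      case (elim x)
      show ?case using elim D(3)[of x] K logf[of x] by (auto simp: abs_mult intro!: mult_mono)
    qed
  qed measurable
  have int_DlogD: "integrable Q (\<lambda>x. D x * log 2 (D x))"
  \<comment> \<open>A crude bound for both signs: \<open>t ln t\<close> is at most
    \<open>t (t - 1)\<close> for the density \<open>t \<le> K + 1\<close>, and at least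
    \<open>t - 1\<close>, hence at least -1.\<close>
  proof (rule Q.integrable_const_bound[where B = "(K + 2)\<^sup>2 / ln 2"])
    show "AE x in Q. norm (D x * log 2 (D x)) \<le> (K + 2)\<^sup>2 / ln 2"
      using bound
    proof eventually_elim
      case (elim x)
      have "\<bar>D x * ln (D x)\<bar> \<le> (K + 2)\<^sup>2"
      proof (cases "D x = 0")
        case False
        then have pos: "0 < D x" using D(3)[of x] by simp
        have "D x * ln (D x) \<le> D x * (D x - 1)"
          using pos by (intro mult_left_mono ln_le_minus_one) auto
        moreover have "D x * (D x - 1) \<le> (K + 2) * (K + 2)"
          using pos elim K by (intro order.trans[OF mult_left_mono[of "D x - 1" "D x"] mult_mono']) auto
        moreover have "D x * - ln (D x) \<le> D x * (1 / D x - 1)"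
          using pos ln_le_minus_one[of "1 / D x"] by (intro mult_left_mono) (auto simp: ln_div)
        moreover have "D x * (1 / D x - 1) \<le> 1" using pos by (simp add: right_diff_distrib)
        moreover have "1 \<le> (K + 2) * (K + 2)" using K by (intro mult_ge1_I) auto
        ultimately show ?thesis by (simp add: power2_eq_square abs_le_iff)
      qed simp
      then have "\<bar>D x * ln (D x)\<bar> / ln 2 \<le> (K + 2)\<^sup>2 / ln 2" by (intro divide_right_mono) auto
      then show ?case by (simp add: log_def abs_mult)
    qed
  qed measurable
  have "(\<integral>x. log 2 (f x) \<partial>P) = (\<integral>x. D x * log 2 (f x) \<partial>Q)"
    unfolding P_eq by (subst integral_density) (use D in auto)
  moreover have "KL_divergence 2 Q P = (\<integral>x. D x * log 2 (D x) \<partial>Q)"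
    unfolding P_eq by (rule Q.KL_density) (use D in auto)
  moreover have "(\<integral>x. D x * log 2 (f x) \<partial>Q) - (\<integral>x. D x * log 2 (D x) \<partial>Q) \<le> 0"
  proof -
    have "(\<integral>x. D x * log 2 (f x) \<partial>Q) - (\<integral>x. D x * log 2 (D x) \<partial>Q) =
      (\<integral>x. D x * log 2 (f x) - D x * log 2 (D x) \<partial>Q)"
      using int_Dlogf int_DlogD by simp
    \<comment> \<open>Pointwise this is \<open>ln t \<le> t - 1\<close> at
      \<open>t = f x / D x\<close>. The integral on the right is at most 0 because \<open>D\<close>
      has integral 1 and \<open>f\<close> at most 1.\<close>
    also have "\<dots> \<le> (\<integral>x. (f x - D x) / ln 2 \<partial>Q)"
    proof (rule integral_mono)
      fix x
      show "D x * log 2 (f x) - D x * log 2 (D x) \<le> (f x - D x) / ln 2"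
      proof (cases "D x = 0")
        case True
        have "0 \<le> f x" using f(2) f(3)[of x] by simp
        then show ?thesis using True by simp
      next
        case False
        then have pos: "0 < D x" "0 < f x" using D(3)[of x] f(2) f(3)[of x] by auto
        have "D x * (ln (f x) - ln (D x)) = D x * ln (f x / D x)" using pos by (simp add: ln_div)
        also have "\<dots> \<le> D x * (f x / D x - 1)"
          using pos by (intro mult_left_mono ln_le_minus_one) auto
        also have "\<dots> = f x - D x" using pos by (simp add: field_simps)
        finally have "D x * (ln (f x) - ln (D x)) / ln 2 \<le> (f x - D x) / ln 2"
          by (rule divide_right_mono) simp
        then show ?thesis by (simp add: log_def field_simps)
      qed
    qed (use int_Dlogf int_DlogD int_f P1 in auto)
    also have "\<dots> = ((\<integral>x. f x \<partial>Q) - 1) / ln 2" using int_f P1 by simp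
    also have "\<dots> \<le> 0" using int1 by (intro divide_nonpos_pos) auto
    finally show ?thesis .
  qed
  ultimately show ?thesis by simp
qed

section \<open>Mutual information with a variable of finite range\<close>

context prob_space
begin

text \<open>For \<open>p u = P(U = u) > 0\<close>, the probability of \<open>U = u\<close> and
  \<open>Y \<in> B\<close> is at most that of \<open>Y \<in> B\<close>, which is the product measure
  of \<open>{u} \<times> B\<close> divided by \<open>p u\<close>. Summing over \<open>u\<close>
  gives \<open>K\<close> as the sum of \<open>1 / p u\<close>; values with \<open>p u = 0\<close>
  contribute null events, and \<open>1 / 0 = 0\<close> suits them.\<close>

lemma distr_Pair_le_pair_distr:
  assumes [measurable]: "U \<in> M \<rightarrow>\<^sub>M S" "Y \<in> M \<rightarrow>\<^sub>M T"
    and F: "finite F" "\<And>\<omega>. \<omega> \<in> space M \<Longrightarrow> U \<omega> \<in> F" "\<And>u. u \<in> F \<Longrightarrow> {u} \<in> sets S"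
  obtains K where "\<And>A. A \<in> sets (S \<Otimes>\<^sub>M T) \<Longrightarrow>
    measure (distr M (S \<Otimes>\<^sub>M T) (\<lambda>\<omega>. (U \<omega>, Y \<omega>))) A \<le> K * measure (distr M S U \<Otimes>\<^sub>M distr M T Y) A"
proof
  interpret dU: prob_space "distr M S U" by (rule prob_space_distr) simp
  interpret dY: prob_space "distr M T Y" by (rule prob_space_distr) simp
  interpret dUY: pair_prob_space "distr M S U" "distr M T Y" ..
  define p where "p u = prob {\<omega>\<in>space M. U \<omega> = u}" for u
  fix A assume A[measurable]: "A \<in> sets (S \<Otimes>\<^sub>M T)"
  let ?Q = "measure (distr M S U \<Otimes>\<^sub>M distr M T Y) A"
  define E where "E u = {\<omega>\<in>space M. U \<omega> = u \<and> (U \<omega>, Y \<omega>) \<in> A}" for u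
  have Ueq[measurable]: "{\<omega>\<in>space M. U \<omega> = u} \<in> sets M" if "u \<in> F" for u
  proof -
    have "{\<omega>\<in>space M. U \<omega> = u} = U -` {u} \<inter> space M" by auto
    then show ?thesis using measurable_sets[OF assms(1) F(3)[OF that]] by simp
  qed
  have E_eq: "E u = {\<omega>\<in>space M. U \<omega> = u} \<inter> {\<omega>\<in>space M. (U \<omega>, Y \<omega>) \<in> A}" for u by (auto simp: E_def)
  have E[measurable]: "E u \<in> sets M" if "u \<in> F" for u
    unfolding E_eq using that by (intro sets.Int Ueq) measurable
  have "measure (distr M (S \<Otimes>\<^sub>M T) (\<lambda>\<omega>. (U \<omega>, Y \<omega>))) A = prob (\<Union>u\<in>F. E u)"
    by (subst measure_distr) (use F(2) in \<open>auto intro!: arg_cong[where f = prob] simp: E_def\<close>)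
  also have "\<dots> \<le> (\<Sum>u\<in>F. prob (E u))"
    by (rule finite_measure_subadditive_finite) (use F(1) E in auto)
  also have "\<dots> \<le> (\<Sum>u\<in>F. 1 / p u * ?Q)"
  proof (rule sum_mono)
    fix u assume u: "u \<in> F"
    show "prob (E u) \<le> 1 / p u * ?Q"
    proof (cases "p u = 0")
      case True
      have "prob (E u) \<le> p u" unfolding p_def by (rule finite_measure_mono) (use u in \<open>auto simp: E_def\<close>)
      then show ?thesis using True by simp
    next
      case False
      then have pos: "0 < p u" by (simp add: p_def zero_less_measure_iff)
      define B where "B = Pair u -` A"
      have B[measurable]: "B \<in> sets T" unfolding B_def by (rule sets_Pair1) (rule A)
      have "prob (E u) \<le> measure (distr M T Y) B"
        by (subst measure_distr) (auto intro!: finite_measure_mono simp: E_def B_def)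
      moreover have "p u * measure (distr M T Y) B = measure (distr M S U \<Otimes>\<^sub>M distr M T Y) ({u} \<times> B)"
      proof -
        have "measure (distr M S U) {u} = p u"
          unfolding p_def by (subst measure_distr)
            (use F(3)[OF u] in \<open>auto intro!: arg_cong[where f = prob]\<close>)
        then show ?thesis using F(3)[OF u] dY.emeasure_pair_measure_Times[of "{u}" "distr M S U" B]
          by (simp add: measure_def enn2real_mult)
      qed
      moreover have "\<dots> \<le> ?Q"
        by (rule dUY.finite_measure_mono) (auto simp: B_def)
      ultimately show ?thesis using pos by (simp add: field_simps) (smt (verit) mult_left_mono)
    qed
  qed
  also have "\<dots> = (\<Sum>u\<in>F. 1 / p u) * ?Q" by (rule sum_distrib_right[symmetric])
  finally show "measure (distr M (S \<Otimes>\<^sub>M T) (\<lambda>\<omega>. (U \<omega>, Y \<omega>))) A \<le> (\<Sum>u\<in>F. 1 / p u) * ?Q" .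
qed

text \<open>Only measurability is asked of \<open>Y\<close>, which will contain random strings. The
  finite range of \<open>U\<close> supplies the bounded density.\<close>

lemma mutual_information_ge_integral_log:
  assumes [measurable]: "U \<in> M \<rightarrow>\<^sub>M S" "Y \<in> M \<rightarrow>\<^sub>M T"
    and F: "finite F" "\<And>\<omega>. \<omega> \<in> space M \<Longrightarrow> U \<omega> \<in> F" "\<And>u. u \<in> F \<Longrightarrow> {u} \<in> sets S"
    and f[measurable]: "f \<in> borel_measurable (S \<Otimes>\<^sub>M T)" and ab: "0 < a" "\<And>z. a \<le> f z" "\<And>z. f z \<le> b"
    and int1: "(\<integral>z. f z \<partial>(distr M S U \<Otimes>\<^sub>M distr M T Y)) \<le> 1"
  shows "(\<integral>\<omega>. log 2 (f (U \<omega>, Y \<omega>)) \<partial>M) \<le> mutual_information 2 S T U Y"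
proof -
  interpret dU: prob_space "distr M S U" by (rule prob_space_distr) simp
  interpret dY: prob_space "distr M T Y" by (rule prob_space_distr) simp
  interpret dUY: pair_prob_space "distr M S U" "distr M T Y" ..
  obtain K where K: "\<And>A. A \<in> sets (S \<Otimes>\<^sub>M T) \<Longrightarrow>
    measure (distr M (S \<Otimes>\<^sub>M T) (\<lambda>\<omega>. (U \<omega>, Y \<omega>))) A \<le> K * measure (distr M S U \<Otimes>\<^sub>M distr M T Y) A"
    using distr_Pair_le_pair_distr[OF assms(1,2) F] by blast
  have sets_eq: "sets (distr M S U \<Otimes>\<^sub>M distr M T Y) = sets (S \<Otimes>\<^sub>M T)"
    by (intro sets_pair_measure_cong) auto
  have "(\<integral>z. log 2 (f z) \<partial>distr M (S \<Otimes>\<^sub>M T) (\<lambda>\<omega>. (U \<omega>, Y \<omega>))) \<le> mutual_information 2 S T U Y"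
    unfolding mutual_information_def
  proof (rule KL_divergence_ge_integral_log[where K = K and a = a and b = b])
    show "prob_space (distr M S U \<Otimes>\<^sub>M distr M T Y)" by unfold_locales
    show "prob_space (distr M (S \<Otimes>\<^sub>M T) (\<lambda>\<omega>. (U \<omega>, Y \<omega>)))" by (rule prob_space_distr) simp
    show "f \<in> borel_measurable (distr M S U \<Otimes>\<^sub>M distr M T Y)"
      using f by (simp add: measurable_cong_sets[OF sets_eq])
  qed (use K ab int1 sets_eq in auto)
  moreover have "(\<integral>z. log 2 (f z) \<partial>distr M (S \<Otimes>\<^sub>M T) (\<lambda>\<omega>. (U \<omega>, Y \<omega>))) = (\<integral>\<omega>. log 2 (f (U \<omega>, Y \<omega>)) \<partial>M)"
    by (rule integral_distr) measurable
  ultimately show ?thesis by simp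
qed

text \<open>The test function is 1. This disposes of the terms that the lower bound drops: the first
  term of every player and the second one of player 1.\<close>

lemma mutual_information_nonneg_finite_range:
  assumes "U \<in> M \<rightarrow>\<^sub>M S" "Y \<in> M \<rightarrow>\<^sub>M T"
    and "finite F" "\<And>\<omega>. \<omega> \<in> space M \<Longrightarrow> U \<omega> \<in> F" "\<And>u. u \<in> F \<Longrightarrow> {u} \<in> sets S"
  shows "0 \<le> mutual_information 2 S T U Y"
proof -
  interpret dU: prob_space "distr M S U" by (rule prob_space_distr) fact
  interpret dY: prob_space "distr M T Y" by (rule prob_space_distr) fact
  interpret dUY: pair_prob_space "distr M S U" "distr M T Y" ..
  show ?thesis
    using mutual_information_ge_integral_log[OF assms, of "\<lambda>_. 1" 1 1] by (simp add: dUY.prob_space)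
qed

lemma mutual_information_indep_eq_0:
  assumes "U \<in> M \<rightarrow>\<^sub>M S" "Y \<in> M \<rightarrow>\<^sub>M T"
    and "distr M (S \<Otimes>\<^sub>M T) (\<lambda>\<omega>. (U \<omega>, Y \<omega>)) = distr M S U \<Otimes>\<^sub>M distr M T Y"
  shows "mutual_information b S T U Y = 0"
proof -
  interpret dU: prob_space "distr M S U" by (rule prob_space_distr) fact
  interpret dY: prob_space "distr M T Y" by (rule prob_space_distr) fact
  interpret dUY: pair_prob_space "distr M S U" "distr M T Y" ..
  show ?thesis unfolding mutual_information_def assms(3) by (rule dUY.KL_same_eq_0)
qed

end

text \<open>Distributivity, by splitting off the first bit. It evaluates the mean of a product test
  function under the uniform law on bit strings.\<close>

lemma sum_prod_bool_lists:
  fixes h :: "nat \<Rightarrow> bool \<Rightarrow> 'a::comm_semiring_1"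
  shows "(\<Sum>u | length u = n. \<Prod>q<n. h q (u ! q)) = (\<Prod>q<n. h q True + h q False)"
proof (induction n arbitrary: h)
  case (Suc n)
  let ?L = "{u::bool list. length u = n}"
  have fin: "finite ?L" using finite_lists_length_eq[of "UNIV :: bool set" n] by simp
  have "{u::bool list. length u = Suc n} = Cons True ` ?L \<union> Cons False ` ?L"
    by (auto simp: length_Suc_conv)
  then have "(\<Sum>u | length u = Suc n. \<Prod>q<Suc n. h q (u ! q)) =
    (\<Sum>u\<in>Cons True ` ?L. \<Prod>q<Suc n. h q (u ! q)) + (\<Sum>u\<in>Cons False ` ?L. \<Prod>q<Suc n. h q (u ! q))"
    using fin by (simp only:) (rule sum.union_disjoint, auto)
  also have "\<dots> = (h 0 True + h 0 False) * (\<Sum>u\<in>?L. \<Prod>q<n. h (Suc q) (u ! q))"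
    by (simp add: sum.reindex prod.lessThan_Suc_shift sum_distrib_left[symmetric] distrib_right del: prod.lessThan_Suc)
  also have "\<dots> = (\<Prod>q<Suc n. h q True + h q False)"
    by (subst Suc.IH) (simp add: prod.lessThan_Suc_shift del: prod.lessThan_Suc)
  finally show ?case .
qed simp

text \<open>
  The test function is the likelihood ratio of a noisy copy of the guess against the uniform
  distribution: every coordinate agrees with the guess with probability \<open>(1 + \<eta>) / 2\<close>.
\<close>

lemma (in prob_space) mutual_information_ge_guess:
  fixes U :: "'a \<Rightarrow> bool list"
  assumes U[measurable]: "U \<in> M \<rightarrow>\<^sub>M count_space UNIV" and Y[measurable]: "Y \<in> M \<rightarrow>\<^sub>M T"
    and len: "\<And>\<omega>. \<omega> \<in> space M \<Longrightarrow> length (U \<omega>) = n"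
    and unif: "\<And>u. length u = n \<Longrightarrow> prob {\<omega>\<in>space M. U \<omega> = u} = 1 / 2 ^ n"
    and guess[measurable]: "\<And>q. Measurable.pred T (guess q)"
    and correct: "\<And>q. q < n \<Longrightarrow> 1 - \<epsilon> \<le> prob {\<omega>\<in>space M. guess q (Y \<omega>) = U \<omega> ! q}"
    and \<eta>: "0 < \<eta>" "\<eta> < 1"
  shows "real n * ((1 - \<epsilon>) * log 2 (1 + \<eta>) + \<epsilon> * log 2 (1 - \<eta>)) \<le> mutual_information 2 (count_space UNIV) T U Y"
proof -
  let ?S = "count_space (UNIV :: bool list set)"
  interpret dU: prob_space "distr M ?S U" by (rule prob_space_distr) simp
  interpret dY: prob_space "distr M T Y" by (rule prob_space_distr) simp
  interpret dUY: pair_prob_space "distr M ?S U" "distr M T Y" ..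
  let ?L = "{u::bool list. length u = n}"
  have fin: "finite ?L" using finite_lists_length_eq[of "UNIV :: bool set" n] by simp
  define w where "w z q = (if guess q (snd z) = fst z ! q then 1 + \<eta> else 1 - \<eta>)" for z q
  define f where "f z = (\<Prod>q<n. w z q)" for z
  have [measurable]: "(\<lambda>z. (fst z :: bool list) ! q) \<in> ?S \<Otimes>\<^sub>M T \<rightarrow>\<^sub>M count_space UNIV" for q
    by (rule measurable_compose[OF measurable_fst]) simp
  have w[measurable]: "(\<lambda>z. w z q) \<in> borel_measurable (?S \<Otimes>\<^sub>M T)" for q
    unfolding w_def by measurable
  have f[measurable]: "f \<in> borel_measurable (?S \<Otimes>\<^sub>M T)" unfolding f_def by measurable
  have w_pos: "0 < w z q" for z q using \<eta> by (simp add: w_def)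
  have lower: "(1 - \<eta>) ^ n \<le> f z" for z
    using prod_mono[of "{..<n}" "\<lambda>_. 1 - \<eta>" "w z"] \<eta> by (simp add: f_def w_def)
  have upper: "f z \<le> (1 + \<eta>) ^ n" for z
    using prod_mono[of "{..<n}" "w z" "\<lambda>_. 1 + \<eta>"] \<eta> by (simp add: f_def w_def)
  have Ueq[measurable]: "{\<omega>\<in>space M. U \<omega> = u} \<in> sets M" for u by measurable
  \<comment> \<open>For a fixed \<open>y\<close>, each coordinate contributes
    \<open>(1 + \<eta>) + (1 - \<eta>) = 2\<close> whatever the guess is, and the \<open>n\<close>
    factors 2 cancel the uniform weight. Hence \<open>f\<close> has integral 1 under the product
    measure.\<close>
  have inner: "(\<integral>u. f (u, y) \<partial>distr M ?S U) = 1" for y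
  proof -
    have "(\<integral>u. f (u, y) \<partial>distr M ?S U) = (\<integral>\<omega>. f (U \<omega>, y) \<partial>M)"
      by (rule integral_distr) auto
    also have "\<dots> = (\<integral>\<omega>. (\<Sum>u\<in>?L. f (u, y) * indicator {\<omega>\<in>space M. U \<omega> = u} \<omega>) \<partial>M)"
    proof (rule Bochner_Integration.integral_cong)
      fix \<omega> assume "\<omega> \<in> space M"
      then have "(\<Sum>u\<in>?L. f (u, y) * indicator {\<omega>\<in>space M. U \<omega> = u} \<omega>) =
        (\<Sum>u\<in>?L. if u = U \<omega> then f (u, y) else 0)"
        by (intro sum.cong) (auto simp: indicator_def)
      then show "f (U \<omega>, y) = (\<Sum>u\<in>?L. f (u, y) * indicator {\<omega>\<in>space M. U \<omega> = u} \<omega>)"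
        using fin len[OF \<open>\<omega> \<in> space M\<close>] by simp
    qed simp
    also have "\<dots> = (\<Sum>u\<in>?L. f (u, y) * prob {\<omega>\<in>space M. U \<omega> = u})"
      by (subst Bochner_Integration.integral_sum) (auto simp: emeasure_eq_measure)
    also have "\<dots> = (\<Sum>u\<in>?L. f (u, y)) / 2 ^ n"
      by (simp add: unif sum_divide_distrib)
    also have "(\<Sum>u\<in>?L. f (u, y)) = (\<Prod>q<n. (if guess q y = True then 1 + \<eta> else 1 - \<eta>) +
        (if guess q y = False then 1 + \<eta> else 1 - \<eta>))"
      unfolding f_def w_def fst_conv snd_conv
      by (rule sum_prod_bool_lists[where h = "\<lambda>q b. if guess q y = b then 1 + \<eta> else 1 - \<eta>"])
    also have "\<dots> = (\<Prod>q<n. 2)" by (rule prod.cong) auto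
    finally show ?thesis by simp
  qed
  have int_f: "integrable (distr M ?S U \<Otimes>\<^sub>M distr M T Y) f"
  proof (rule dUY.integrable_const_bound[where B = "(1 + \<eta>) ^ n"])
    show "AE z in distr M ?S U \<Otimes>\<^sub>M distr M T Y. norm (f z) \<le> (1 + \<eta>) ^ n"
      using upper by (intro AE_I2) (simp add: f_def w_pos less_imp_le prod_nonneg)
    have "sets (distr M ?S U \<Otimes>\<^sub>M distr M T Y) = sets (?S \<Otimes>\<^sub>M T)"
      by (intro sets_pair_measure_cong) auto
    then show "f \<in> borel_measurable (distr M ?S U \<Otimes>\<^sub>M distr M T Y)"
      using f by (simp cong: measurable_cong_sets)
  qed
  have one: "(\<integral>z. f z \<partial>(distr M ?S U \<Otimes>\<^sub>M distr M T Y)) = 1"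
    using dUY.integral_snd[of "\<lambda>u y. f (u, y)"] int_f inner dY.prob_space by simp
  have "(\<integral>\<omega>. log 2 (f (U \<omega>, Y \<omega>)) \<partial>M) \<le> mutual_information 2 ?S T U Y"
    by (rule mutual_information_ge_integral_log[where F = ?L and a = "(1 - \<eta>) ^ n" and b = "(1 + \<eta>) ^ n"])
      (use fin len lower upper \<eta> one f in auto)
  \<comment> \<open>The logarithm turns the product into a sum, so by linearity of the integral only
    the success probabilities of the single coordinates enter.\<close>
  moreover have "(\<integral>\<omega>. log 2 (f (U \<omega>, Y \<omega>)) \<partial>M) =
    (\<Sum>q<n. prob {\<omega>\<in>space M. guess q (Y \<omega>) = U \<omega> ! q} * (log 2 (1 + \<eta>) - log 2 (1 - \<eta>)) + log 2 (1 - \<eta>))"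
  proof -
    let ?C = "\<lambda>q. {\<omega>\<in>space M. guess q (Y \<omega>) = U \<omega> ! q}"
    have UY: "(\<lambda>\<omega>. (U \<omega>, Y \<omega>)) \<in> M \<rightarrow>\<^sub>M ?S \<Otimes>\<^sub>M T" by measurable
    have C: "?C q \<in> sets M" for q
    proof -
      have "Measurable.pred (?S \<Otimes>\<^sub>M T) (\<lambda>z. guess q (snd z) = fst z ! q)" by measurable
      from measurable_compose[OF UY this] show ?thesis by (simp add: pred_def)
    qed
    have "(\<integral>\<omega>. log 2 (f (U \<omega>, Y \<omega>)) \<partial>M) = (\<integral>\<omega>. (\<Sum>q<n.
        indicator (?C q) \<omega> * (log 2 (1 + \<eta>) - log 2 (1 - \<eta>)) + log 2 (1 - \<eta>)) \<partial>M)"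
    proof (rule Bochner_Integration.integral_cong)
      fix \<omega> assume \<omega>: "\<omega> \<in> space M"
      have "log 2 (f (U \<omega>, Y \<omega>)) = (\<Sum>q<n. log 2 (w (U \<omega>, Y \<omega>) q))"
        unfolding f_def log_def using w_pos by (subst ln_prod) (auto simp: sum_divide_distrib less_imp_neq[THEN not_sym])
      also have "\<dots> = (\<Sum>q<n. indicator (?C q) \<omega> * (log 2 (1 + \<eta>) - log 2 (1 - \<eta>)) + log 2 (1 - \<eta>))"
        using \<omega> by (intro sum.cong) (auto simp: w_def indicator_def)
      finally show "log 2 (f (U \<omega>, Y \<omega>)) =
        (\<Sum>q<n. indicator (?C q) \<omega> * (log 2 (1 + \<eta>) - log 2 (1 - \<eta>)) + log 2 (1 - \<eta>))" .
    qed simp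
    also have "\<dots> = (\<Sum>q<n. prob (?C q) * (log 2 (1 + \<eta>) - log 2 (1 - \<eta>)) + log 2 (1 - \<eta>))"
      by (subst Bochner_Integration.integral_sum) (use C in \<open>auto simp: emeasure_eq_measure prob_space\<close>)
    finally show ?thesis .
  qed
  moreover have "(\<Sum>q<n. (1 - \<epsilon>) * (log 2 (1 + \<eta>) - log 2 (1 - \<eta>)) + log 2 (1 - \<eta>)) \<le>
    (\<Sum>q<n. prob {\<omega>\<in>space M. guess q (Y \<omega>) = U \<omega> ! q} * (log 2 (1 + \<eta>) - log 2 (1 - \<eta>)) + log 2 (1 - \<eta>))"
  proof (rule sum_mono)
    fix q assume "q \<in> {..<n}"
    moreover have "0 \<le> log 2 (1 + \<eta>) - log 2 (1 - \<eta>)" using \<eta> by simp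
    ultimately show "(1 - \<epsilon>) * (log 2 (1 + \<eta>) - log 2 (1 - \<eta>)) + log 2 (1 - \<eta>) \<le>
      prob {\<omega>\<in>space M. guess q (Y \<omega>) = U \<omega> ! q} * (log 2 (1 + \<eta>) - log 2 (1 - \<eta>)) + log 2 (1 - \<eta>)"
      using mult_right_mono[OF correct] by simp
  qed
  ultimately show ?thesis by (simp add: algebra_simps)
qed

text \<open>The best choice would be \<open>\<eta> = 1 - 2 * \<epsilon>\<close>, which yields 1
  minus the binary entropy of \<epsilon> but degenerates to \<open>log 2 0\<close> at
  \<open>\<epsilon> = 0\<close>. A quarter of it stays away from 1, and quadratic bounds on
  \<open>ln\<close> then suffice.\<close>

lemma guess_bound_pos:
  fixes \<epsilon> :: real
  assumes "0 \<le> \<epsilon>" "\<epsilon> < 1 / 2"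
  defines "\<eta> \<equiv> (1 - 2 * \<epsilon>) / 4"
  shows "0 < (1 - \<epsilon>) * log 2 (1 + \<eta>) + \<epsilon> * log 2 (1 - \<eta>)"
proof -
  have \<eta>: "0 < \<eta>" "\<eta> \<le> 1 / 4" using assms by (auto simp: \<eta>_def)
  have "\<eta> - \<eta>\<^sup>2 \<le> ln (1 + \<eta>)" "- \<eta> - 2 * \<eta>\<^sup>2 \<le> ln (1 - \<eta>)"
    using \<eta> by (auto intro!: ln_one_plus_pos_lower_bound ln_one_minus_pos_lower_bound)
  then have "(1 - \<epsilon>) * (\<eta> - \<eta>\<^sup>2) + \<epsilon> * (- \<eta> - 2 * \<eta>\<^sup>2) \<le> (1 - \<epsilon>) * ln (1 + \<eta>) + \<epsilon> * ln (1 - \<eta>)"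
    using assms by (intro add_mono mult_left_mono) auto
  \<comment> \<open>As \<open>1 - 2 * \<epsilon> = 4 * \<eta>\<close>, the linear part is
    \<open>4 * \<eta> * \<eta>\<close> and beats the quadratic loss.\<close>
  moreover have "(1 - \<epsilon>) * (\<eta> - \<eta>\<^sup>2) + \<epsilon> * (- \<eta> - 2 * \<eta>\<^sup>2) = \<eta> * (4 * \<eta> - (1 + \<epsilon>) * \<eta>)"
    by (simp add: \<eta>_def power2_eq_square field_simps)
  moreover have "0 < \<eta> * (4 * \<eta> - (1 + \<epsilon>) * \<eta>)"
  proof -
    have "(1 + \<epsilon>) * \<eta> < 4 * \<eta>" using \<eta> assms by (intro mult_strict_right_mono) auto
    then show ?thesis using \<eta> by simp
  qed
  ultimately have "0 < ((1 - \<epsilon>) * ln (1 + \<eta>) + \<epsilon> * ln (1 - \<eta>)) / ln 2" by simp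
  then show ?thesis by (simp add: log_def add_divide_distrib)
qed

section \<open>Independence of the inputs\<close>

text \<open>\<open>M1\<close> will carry the inputs and \<open>M2\<close> the strings. For each
  fixed point of \<open>M2\<close> the event factorizes on \<open>M1\<close>; the factor of
  \<open>U\<close> does not depend on that point and leaves the integral over
  \<open>M2\<close>.\<close>

lemma distr_Pair_eq_pair_distr_independent:
  assumes M1: "prob_space M1" and M2: "prob_space M2"
    and [measurable]: "U \<in> M1 \<rightarrow>\<^sub>M S" "V \<in> M1 \<rightarrow>\<^sub>M T" "G \<in> M2 \<rightarrow>\<^sub>M K"
    and indep: "\<And>A B. A \<in> sets S \<Longrightarrow> B \<in> sets T \<Longrightarrow> measure M1 {z\<in>space M1. U z \<in> A \<and> V z \<in> B} =
      measure M1 {z\<in>space M1. U z \<in> A} * measure M1 {z\<in>space M1. V z \<in> B}"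
  defines "M \<equiv> M1 \<Otimes>\<^sub>M M2"
  shows "distr M (S \<Otimes>\<^sub>M (T \<Otimes>\<^sub>M K)) (\<lambda>\<omega>. (U (fst \<omega>), (V (fst \<omega>), G (snd \<omega>)))) =
    distr M S (\<lambda>\<omega>. U (fst \<omega>)) \<Otimes>\<^sub>M distr M (T \<Otimes>\<^sub>M K) (\<lambda>\<omega>. (V (fst \<omega>), G (snd \<omega>)))"
proof (rule sym, rule pair_measure_eqI)
  interpret M1: prob_space M1 by fact
  interpret M2: prob_space M2 by fact
  interpret M12: pair_prob_space M1 M2 ..
  have [measurable]: "(\<lambda>\<omega>. U (fst \<omega>)) \<in> M \<rightarrow>\<^sub>M S"
    "(\<lambda>\<omega>. (V (fst \<omega>), G (snd \<omega>))) \<in> M \<rightarrow>\<^sub>M T \<Otimes>\<^sub>M K"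
    unfolding M_def by measurable
  interpret dU: prob_space "distr M S (\<lambda>\<omega>. U (fst \<omega>))"
    unfolding M_def by (rule M12.prob_space_distr) measurable
  interpret dV: prob_space "distr M (T \<Otimes>\<^sub>M K) (\<lambda>\<omega>. (V (fst \<omega>), G (snd \<omega>)))"
    unfolding M_def by (rule M12.prob_space_distr) measurable
  show "sigma_finite_measure (distr M S (\<lambda>\<omega>. U (fst \<omega>)))" ..
  show "sigma_finite_measure (distr M (T \<Otimes>\<^sub>M K) (\<lambda>\<omega>. (V (fst \<omega>), G (snd \<omega>))))" ..
  show "sets (distr M S (\<lambda>\<omega>. U (fst \<omega>)) \<Otimes>\<^sub>M distr M (T \<Otimes>\<^sub>M K) (\<lambda>\<omega>. (V (fst \<omega>), G (snd \<omega>)))) =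
    sets (distr M (S \<Otimes>\<^sub>M (T \<Otimes>\<^sub>M K)) (\<lambda>\<omega>. (U (fst \<omega>), (V (fst \<omega>), G (snd \<omega>)))))"
    unfolding sets_distr by (intro sets_pair_measure_cong) auto
  fix A B assume "A \<in> sets (distr M S (\<lambda>\<omega>. U (fst \<omega>)))"
    and "B \<in> sets (distr M (T \<Otimes>\<^sub>M K) (\<lambda>\<omega>. (V (fst \<omega>), G (snd \<omega>))))"
  then have A[measurable]: "A \<in> sets S" and B[measurable]: "B \<in> sets (T \<Otimes>\<^sub>M K)" by simp_all
  define By where "By y = {v. (v, G y) \<in> B}" for y
  have By: "By y \<in> sets T" for y
    using sets_Pair2[OF B, of "G y"] by (simp add: By_def vimage_def)
  have By_eq: "emeasure M1 {z\<in>space M1. U z \<in> A \<and> V z \<in> By y} =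
    emeasure M1 {z\<in>space M1. U z \<in> A} * emeasure M1 {z\<in>space M1. V z \<in> By y}" for y
    by (simp add: M1.emeasure_eq_measure indep[OF A By] ennreal_mult)
  have V_meas: "{\<omega>\<in>space M. (V (fst \<omega>), G (snd \<omega>)) \<in> B} \<in> sets (M1 \<Otimes>\<^sub>M M2)"
    unfolding M_def by measurable
  have UV_meas: "{\<omega>\<in>space M. U (fst \<omega>) \<in> A \<and> (V (fst \<omega>), G (snd \<omega>)) \<in> B} \<in> sets (M1 \<Otimes>\<^sub>M M2)"
    unfolding M_def by measurable
  have V_int: "emeasure M {\<omega>\<in>space M. (V (fst \<omega>), G (snd \<omega>)) \<in> B} =
    (\<integral>\<^sup>+y. emeasure M1 {z\<in>space M1. V z \<in> By y} \<partial>M2)"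
    unfolding M_def M12.emeasure_pair_measure_alt2[OF V_meas[unfolded M_def]]
    by (intro nn_integral_cong arg_cong[where f = "emeasure M1"]) (auto simp: space_pair_measure By_def)
  have V_fun: "(\<lambda>y. emeasure M1 {z\<in>space M1. V z \<in> By y}) \<in> borel_measurable M2"
  proof -
    have "(\<lambda>y. emeasure M1 ((\<lambda>x. (x, y)) -` {\<omega>\<in>space M. (V (fst \<omega>), G (snd \<omega>)) \<in> B})) \<in> borel_measurable M2"
      by (rule M12.measurable_emeasure_Pair2[OF V_meas])
    also have "?this \<longleftrightarrow> ?thesis"
      by (intro measurable_cong arg_cong[where f = "emeasure M1"]) (auto simp: M_def space_pair_measure By_def)
    finally show ?thesis .
  qed
  have U_eq: "emeasure M {\<omega>\<in>space M. U (fst \<omega>) \<in> A} = emeasure M1 {z\<in>space M1. U z \<in> A}"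
  proof -
    have "{\<omega>\<in>space M. U (fst \<omega>) \<in> A} = {z\<in>space M1. U z \<in> A} \<times> space M2"
      by (auto simp: M_def space_pair_measure)
    then show ?thesis unfolding M_def by (simp add: M2.emeasure_pair_measure_Times M2.emeasure_space_1)
  qed
  have "emeasure M {\<omega>\<in>space M. U (fst \<omega>) \<in> A \<and> (V (fst \<omega>), G (snd \<omega>)) \<in> B} =
    (\<integral>\<^sup>+y. emeasure M1 {z\<in>space M1. U z \<in> A \<and> V z \<in> By y} \<partial>M2)"
    unfolding M_def M12.emeasure_pair_measure_alt2[OF UV_meas[unfolded M_def]]
    by (intro nn_integral_cong arg_cong[where f = "emeasure M1"]) (auto simp: space_pair_measure By_def)
  also have "\<dots> = emeasure M1 {z\<in>space M1. U z \<in> A} * (\<integral>\<^sup>+y. emeasure M1 {z\<in>space M1. V z \<in> By y} \<partial>M2)"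
    unfolding By_eq by (rule nn_integral_cmult[OF V_fun])
  finally have main: "emeasure M {\<omega>\<in>space M. U (fst \<omega>) \<in> A \<and> (V (fst \<omega>), G (snd \<omega>)) \<in> B} =
    emeasure M {\<omega>\<in>space M. U (fst \<omega>) \<in> A} * emeasure M {\<omega>\<in>space M. (V (fst \<omega>), G (snd \<omega>)) \<in> B}"
    unfolding V_int U_eq .
  show "emeasure (distr M S (\<lambda>\<omega>. U (fst \<omega>))) A *
      emeasure (distr M (T \<Otimes>\<^sub>M K) (\<lambda>\<omega>. (V (fst \<omega>), G (snd \<omega>)))) B =
    emeasure (distr M (S \<Otimes>\<^sub>M (T \<Otimes>\<^sub>M K)) (\<lambda>\<omega>. (U (fst \<omega>), (V (fst \<omega>), G (snd \<omega>))))) (A \<times> B)"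
    using main by (simp add: emeasure_distr vimage_def Int_def conj_commute)
qed

text \<open>Reduces independence and uniformity of the inputs to counting.\<close>

lemma uniform_count_measure_PiE:
  assumes I: "finite I" and A: "finite A" "A \<noteq> {}"
  shows "PiM I (\<lambda>_. uniform_count_measure A) = uniform_count_measure (I \<rightarrow>\<^sub>E A)"
proof (rule measure_eqI_finite)
  interpret A: prob_space "uniform_count_measure A" by (rule prob_space_uniform_count_measure) fact+
  interpret product_sigma_finite "\<lambda>_. uniform_count_measure A" ..
  have "sets (PiM I (\<lambda>_. uniform_count_measure A)) = sets (PiM I (\<lambda>_. count_space A))"
    by (intro sets_PiM_cong) (auto simp: sets_uniform_count_measure)
  also have "\<dots> = Pow (I \<rightarrow>\<^sub>E A)"
    using count_space_PiM_finite[of I "\<lambda>_. A"] I A by (simp add: countable_finite)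
  finally show "sets (PiM I (\<lambda>_. uniform_count_measure A)) = Pow (I \<rightarrow>\<^sub>E A)" .
  show "sets (uniform_count_measure (I \<rightarrow>\<^sub>E A)) = Pow (I \<rightarrow>\<^sub>E A)"
    by (simp add: sets_uniform_count_measure)
  show fin: "finite (I \<rightarrow>\<^sub>E A)" using I A by (intro finite_PiE) auto
  fix z assume z: "z \<in> I \<rightarrow>\<^sub>E A"
  have "emeasure (PiM I (\<lambda>_. uniform_count_measure A)) {z} = emeasure (PiM I (\<lambda>_. uniform_count_measure A)) (PiE I (\<lambda>q. {z q}))"
    using z by (subst PiE_singleton) (auto simp: PiE_def)
  also have "\<dots> = (\<Prod>q\<in>I. emeasure (uniform_count_measure A) {z q})"
    using I z by (intro emeasure_PiM) (auto simp: sets_uniform_count_measure)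
  also have "\<dots> = (\<Prod>q\<in>I. ennreal (1 / real (card A)))"
    using emeasure_uniform_count_measure[OF A(1)] PiE_mem[OF z] by (intro prod.cong refl) simp
  also have "\<dots> = ennreal (1 / real (card (I \<rightarrow>\<^sub>E A)))"
    using I A by (simp add: card_PiE ennreal_power power_divide)
  also have "\<dots> = emeasure (uniform_count_measure (I \<rightarrow>\<^sub>E A)) {z}"
    using z fin by (simp add: emeasure_uniform_count_measure)
  finally show "emeasure (PiM I (\<lambda>_. uniform_count_measure A)) {z} = emeasure (uniform_count_measure (I \<rightarrow>\<^sub>E A)) {z}" .
qed

section \<open>Counting samples by the inputs they give\<close>

definition samples :: "nat \<Rightarrow> nat \<Rightarrow> (nat \<Rightarrow> nat \<Rightarrow> bool) set" where
  "samples k n = {..<n} \<rightarrow>\<^sub>E ({1..k} \<rightarrow>\<^sub>E UNIV)"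

lemma \<mu>_pow_uniform: "\<mu>_pow k n = uniform_count_measure (samples k n)"
proof -
  have "finite ({1..k} \<rightarrow>\<^sub>E (UNIV :: bool set))" by (intro finite_PiE) auto
  moreover have "({1..k} \<rightarrow>\<^sub>E (UNIV :: bool set)) \<noteq> {}" by (simp add: PiE_eq_empty_iff)
  ultimately show ?thesis unfolding \<mu>_pow_def \<mu>_def samples_def by (intro uniform_count_measure_PiE) auto
qed

lemma finite_samples: "finite (samples k n)"
  unfolding samples_def by (intro finite_PiE) auto

lemma samples_nonempty: "samples k n \<noteq> {}"
  by (simp add: samples_def PiE_eq_empty_iff)

lemma prob_space_\<mu>_pow: "prob_space (\<mu>_pow k n)"
  unfolding \<mu>_pow_uniform by (intro prob_space_uniform_count_measure finite_samples samples_nonempty)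

lemma space_\<mu>_pow: "space (\<mu>_pow k n) = samples k n"
  by (simp add: \<mu>_pow_uniform space_uniform_count_measure)

lemma measurable_\<mu>_pow: "f \<in> samples k n \<rightarrow> space N \<Longrightarrow> f \<in> \<mu>_pow k n \<rightarrow>\<^sub>M N"
  by (auto simp: \<mu>_pow_uniform measurable_def space_uniform_count_measure sets_uniform_count_measure)

definition input_of :: "nat \<Rightarrow> nat \<Rightarrow> (nat \<Rightarrow> nat \<Rightarrow> bool) \<Rightarrow> bool list" where
  "input_of n i z = map (\<lambda>q. z q i) [0..<n]"

definition other_inputs :: "nat \<Rightarrow> nat \<Rightarrow> nat \<Rightarrow> (nat \<Rightarrow> nat \<Rightarrow> bool) \<Rightarrow> nat \<Rightarrow> bool list" where
  "other_inputs k n i z = (\<lambda>j\<in>others k i. input_of n j z)"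

text \<open>The bits of player \<open>i\<close> can be changed without touching the other inputs.
  The second factor stays an image, since only its cardinality is needed.\<close>

lemma bij_betw_inputs:
  assumes i: "i \<in> {1..k}"
  shows "bij_betw (\<lambda>z. (input_of n i z, other_inputs k n i z)) (samples k n)
    ({u. length u = n} \<times> other_inputs k n i ` samples k n)"
  unfolding bij_betw_def
proof
  show "inj_on (\<lambda>z. (input_of n i z, other_inputs k n i z)) (samples k n)"
  proof (rule inj_onI)
    fix z z' assume z: "z \<in> samples k n" "z' \<in> samples k n"
      and eq: "(input_of n i z, other_inputs k n i z) = (input_of n i z', other_inputs k n i z')"
    have "other_inputs k n i z j = other_inputs k n i z' j" for j using eq by simp
    then have "input_of n j z = input_of n j z'" if "j \<in> {1..k}" for j
      using eq that by (cases "j = i") (auto simp: other_inputs_def others_def dest: meta_spec[of _ j])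
    then have "z q j = z' q j" if "q < n" "j \<in> {1..k}" for q j
      using that by (auto simp: input_of_def)
    moreover have mem: "z q \<in> {1..k} \<rightarrow>\<^sub>E UNIV" "z' q \<in> {1..k} \<rightarrow>\<^sub>E UNIV" if "q < n" for q
      using z that by (auto simp: samples_def)
    ultimately have "z q = z' q" if "q < n" for q
      by (intro PiE_ext[OF mem[OF that]]) (use that in blast)
    then show "z = z'" by (intro PiE_ext[OF z[unfolded samples_def]]) simp
  qed
  show "(\<lambda>z. (input_of n i z, other_inputs k n i z)) ` samples k n =
    {u. length u = n} \<times> other_inputs k n i ` samples k n"
  proof (intro equalityI subsetI)
    fix p assume "p \<in> {u :: bool list. length u = n} \<times> other_inputs k n i ` samples k n"
    then obtain u z where p: "p = (u, other_inputs k n i z)" "length u = n" "z \<in> samples k n" by auto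
    \<comment> \<open>The sample \<open>z\<close> with the bits of player \<open>i\<close>
      overwritten by \<open>u\<close>.\<close>
    define z' where "z' = (\<lambda>q\<in>{..<n}. (z q)(i := u ! q))"
    have "z' \<in> samples k n"
      using p(3) i unfolding z'_def samples_def by (auto simp: PiE_def extensional_def Pi_def)
    moreover have "input_of n i z' = u"
      using p(2) by (auto simp: input_of_def z'_def intro!: nth_equalityI)
    moreover have "other_inputs k n i z' = other_inputs k n i z"
      by (auto simp: other_inputs_def input_of_def z'_def others_def intro!: restrict_ext)
    ultimately show "p \<in> (\<lambda>z. (input_of n i z, other_inputs k n i z)) ` samples k n"
      unfolding p by (auto intro!: image_eqI[of _ _ z'])
  qed (auto simp: input_of_def)
qed

text \<open>The joint law in product form. Taking \<open>A\<close> or \<open>B\<close> to be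
  \<open>UNIV\<close> gives the marginals, from which independence and uniformity are read
  off.\<close>

lemma measure_inputs:
  assumes i: "i \<in> {1..k}"
  shows "measure (\<mu>_pow k n) {z\<in>samples k n. input_of n i z \<in> A \<and> other_inputs k n i z \<in> B} =
    real (card ({u. length u = n} \<inter> A)) / 2 ^ n *
    (real (card (other_inputs k n i ` samples k n \<inter> B)) / real (card (other_inputs k n i ` samples k n)))"
proof -
  let ?h = "\<lambda>z. (input_of n i z, other_inputs k n i z)"
  let ?L = "{u::bool list. length u = n}" and ?W = "other_inputs k n i ` samples k n"
  note bij = bij_betw_inputs[OF i, of n]
  have cardL: "card ?L = 2 ^ n"
    using card_lists_length_eq[of "UNIV :: bool set" n] by simp
  have img: "?h ` samples k n = ?L \<times> ?W" using bij by (simp add: bij_betw_def)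
  have "?h ` {z\<in>samples k n. input_of n i z \<in> A \<and> other_inputs k n i z \<in> B} = (?L \<inter> A) \<times> (?W \<inter> B)"
  proof (intro equalityI subsetI)
    fix p assume p: "p \<in> (?L \<inter> A) \<times> (?W \<inter> B)"
    then have "p \<in> ?h ` samples k n" unfolding img by auto
    then obtain z where "z \<in> samples k n" "p = ?h z" by blast
    then show "p \<in> ?h ` {z\<in>samples k n. input_of n i z \<in> A \<and> other_inputs k n i z \<in> B}"
      using p by auto
  qed (auto simp: input_of_def)
  then have "bij_betw ?h {z\<in>samples k n. input_of n i z \<in> A \<and> other_inputs k n i z \<in> B} ((?L \<inter> A) \<times> (?W \<inter> B))"
    by (intro bij_betw_subset[OF bij]) auto
  then have "card {z\<in>samples k n. input_of n i z \<in> A \<and> other_inputs k n i z \<in> B} =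
    card (?L \<inter> A) * card (?W \<inter> B)"
    by (simp add: bij_betw_same_card card_cartesian_product)
  moreover have "card (samples k n) = 2 ^ n * card ?W"
    using bij_betw_same_card[OF bij] by (simp add: card_cartesian_product cardL)
  ultimately show ?thesis
    unfolding \<mu>_pow_uniform
    by (subst measure_uniform_count_measure) (auto simp: finite_samples)
qed

lemma inputs_independent:
  assumes i: "i \<in> {1..k}"
  shows "measure (\<mu>_pow k n) {z\<in>space (\<mu>_pow k n). input_of n i z \<in> A \<and> other_inputs k n i z \<in> B} =
    measure (\<mu>_pow k n) {z\<in>space (\<mu>_pow k n). input_of n i z \<in> A} *
    measure (\<mu>_pow k n) {z\<in>space (\<mu>_pow k n). other_inputs k n i z \<in> B}"
proof -
  have "card {u::bool list. length u = n} = 2 ^ n"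
    using card_lists_length_eq[of "UNIV :: bool set" n] by simp
  moreover have "card (other_inputs k n i ` samples k n) \<noteq> 0"
    using finite_samples samples_nonempty by (simp add: card_eq_0_iff)
  ultimately show ?thesis
    using measure_inputs[OF i, of n A UNIV] measure_inputs[OF i, of n UNIV B] measure_inputs[OF i, of n A B]
    unfolding space_\<mu>_pow by simp
qed

lemma input_uniform:
  assumes i: "i \<in> {1..k}" and u: "length u = n"
  shows "measure (\<mu>_pow k n) {z\<in>space (\<mu>_pow k n). input_of n i z = u} = 1 / 2 ^ n"
proof -
  have "card (other_inputs k n i ` samples k n) \<noteq> 0"
    using finite_samples samples_nonempty by (simp add: card_eq_0_iff)
  moreover have "{u. length u = n} \<inter> {u} = {u}" using u by auto
  ultimately show ?thesis
    using measure_inputs[OF i, of n "{u}" UNIV] unfolding space_\<mu>_pow by simp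
qed

section \<open>The lower bound\<close>

lemma countably_valued_measurable_compose:
  assumes g: "countably_valued N g" and f: "f \<in> M \<rightarrow>\<^sub>M N"
  shows "countably_valued M (\<lambda>\<omega>. g (f \<omega>))"
proof (rule measurable_countably_valued)
  show "(\<lambda>\<omega>. g (f \<omega>)) \<in> M \<rightarrow>\<^sub>M count_space UNIV"
    by (rule measurable_compose[OF f countably_valued_measurable[OF g]])
  have "(\<lambda>\<omega>. g (f \<omega>)) ` space M \<subseteq> g ` space N" using measurable_space[OF f] by auto
  then show "countable ((\<lambda>\<omega>. g (f \<omega>)) ` space M)"
    by (rule countable_subset) (use g in \<open>simp add: countably_valued_def\<close>)
qed

lemma PiM_count_space_UNIV:
  "finite I \<Longrightarrow> PiM I (\<lambda>_. count_space (UNIV :: 'b::countable set)) = count_space (I \<rightarrow>\<^sub>E UNIV)"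
  using count_space_PiM_finite[of I "\<lambda>_. UNIV :: 'b set"] by simp

lemma countably_valued_PiM:
  assumes "finite I"
  shows "countably_valued (PiM I (\<lambda>_. count_space (UNIV :: 'b::countable set))) (\<lambda>f. f)"
proof -
  have "{f. f \<in> I \<rightarrow>\<^sub>E (UNIV :: 'b set) \<and> f = c} \<subseteq> I \<rightarrow>\<^sub>E UNIV" for c by auto
  then show ?thesis
    using assms by (simp add: countably_valued_def PiM_count_space_UNIV countable_PiE)
qed

locale parity_protocol =
  fixes k n :: nat and \<epsilon> :: real and \<pi> :: protocol and \<sigma> :: scheduler
  assumes protocol: "is_protocol k \<pi>"
    and computes: "eps_computes_Par k n \<epsilon> \<pi>"
    and scheduler: "is_scheduler k \<sigma>"
begin

text \<open>
  The transcripts do not depend on the scheduler, so a fixed schedule may be used. Unlike the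
  given scheduler, it cannot spoil measurability.
\<close>

definition fixed_schedule :: "nat \<Rightarrow> event" where
  "fixed_schedule = \<sigma> (\<lambda>_. []) (\<lambda>_ _. False) (\<lambda>_. False)"

abbreviation "s0 \<equiv> fixed_schedule"
abbreviation "J \<equiv> joint k n \<pi>"
abbreviation "inputs_space i \<equiv> PiM (others k i) (\<lambda>_. count_space (UNIV :: bool list set))"
abbreviation "rest_space i \<equiv> inputs_space i \<Otimes>\<^sub>M PiM (others k i) (\<lambda>_. rspace)"

definition final0 :: "outcome \<Rightarrow> config" where
  "final0 \<omega> = final k \<pi> (\<lambda>_ _ _. s0) (X_of n \<omega>) (fst (snd \<omega>)) (snd (snd \<omega>))"

lemma fair_s0: "fair k s0"
  using scheduler by (simp add: fixed_schedule_def is_scheduler_def)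

lemma range_s0: "range s0 \<subseteq> events k"
  using fair_s0 by (simp add: fair_def)

lemma finite_others: "finite (others k i)"
  by (simp add: others_def)

lemma X_of_eq: "X_of n \<omega> i = input_of n i (fst \<omega>)"
  by (cases \<omega>) (simp add: X_of_def input_of_def)

lemma X_minus_eq: "X_minus k n i \<omega> = other_inputs k n i (fst \<omega>)"
  by (simp add: X_minus_def other_inputs_def X_of_eq restrict_def fun_eq_iff)

lemma length_X_of: "length (X_of n \<omega> i) = n"
  by (simp add: X_of_eq input_of_def)

lemma halts:
  assumes "is_scheduler k \<sigma>'"
  shows "\<forall>i\<in>{1..k}. \<exists>t. stopped (run \<pi> (X_of n \<omega>) r p (\<sigma>' (X_of n \<omega>) r p) t) i"
  using computes assms length_X_of unfolding eps_computes_Par_def by blast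

lemma is_scheduler_s0: "is_scheduler k (\<lambda>_ _ _. s0)"
  using fair_s0 by (simp add: is_scheduler_def)

lemma loc_final0:
  assumes "i \<in> {1..k}"
  shows "loc (final k \<pi> \<sigma> (X_of n (z, r, p)) r p) i = loc (final0 (z, r, p)) i"
  unfolding final0_def fst_conv snd_conv
  by (rule final_loc_scheduler_independent[OF protocol])
    (use fair_s0 scheduler halts[OF is_scheduler_s0] assms in \<open>auto simp: is_scheduler_def\<close>)

lemma transcript_eq:
  assumes "i \<in> {1..k}"
  shows "transcript k n \<pi> \<sigma> i \<omega> =
    (snd (snd \<omega>), \<lambda>j\<in>others k i. (sent (final0 \<omega>) i j, got (final0 \<omega>) i j))"
proof -
  obtain z r p where \<omega>: "\<omega> = (z, r, p)" by (cases \<omega>) auto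
  show ?thesis
    using loc_eqD(3,4)[OF loc_final0[OF assms, of z r p]] by (simp add: \<omega> transcript_def Let_def)
qed

section \<open>Measurability and independence of the random variables\<close>

lemma prob_space_rand_law: "prob_space (rand_law k \<pi>)"
proof -
  have "prob_space (PiM {1..k} (priv_law \<pi>))"
    using protocol by (intro prob_space_PiM) (auto simp: is_protocol_def)
  moreover have "prob_space (pub_law \<pi>)" using protocol by (auto simp: is_protocol_def)
  ultimately show ?thesis
    unfolding rand_law_def by (rule prob_space_pair)
qed

lemma prob_space_J: "prob_space J"
  unfolding joint_def by (rule prob_space_pair[OF prob_space_\<mu>_pow prob_space_rand_law])

lemma private_string_measurable:
  assumes "i \<in> {1..k}"
  shows "(\<lambda>\<rho>. fst \<rho> i) \<in> rand_law k \<pi> \<rightarrow>\<^sub>M rspace"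
proof -
  have "(\<lambda>\<rho>. fst \<rho> i) \<in> rand_law k \<pi> \<rightarrow>\<^sub>M priv_law \<pi> i"
    unfolding rand_law_def using assms by measurable
  moreover have "sets (priv_law \<pi> i) = sets rspace" using protocol assms by (auto simp: is_protocol_def)
  ultimately show ?thesis by (simp cong: measurable_cong_sets)
qed

lemma public_string_measurable: "snd \<in> rand_law k \<pi> \<rightarrow>\<^sub>M rspace"
proof -
  have "snd \<in> rand_law k \<pi> \<rightarrow>\<^sub>M pub_law \<pi>" unfolding rand_law_def by measurable
  moreover have "sets (pub_law \<pi>) = sets rspace" using protocol by (auto simp: is_protocol_def)
  ultimately show ?thesis by (simp cong: measurable_cong_sets)
qed

lemma other_strings_measurable:
  "(\<lambda>\<rho>. restrict (fst \<rho>) (others k i)) \<in> rand_law k \<pi> \<rightarrow>\<^sub>M PiM (others k i) (\<lambda>_. rspace)"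
  by (rule measurable_restrict) (auto simp: others_def intro: private_string_measurable)

lemma random_strings_J: "random_strings k \<pi> J (\<lambda>\<omega>. fst (snd \<omega>)) (\<lambda>\<omega>. snd (snd \<omega>))"
proof
  have snd: "snd \<in> J \<rightarrow>\<^sub>M rand_law k \<pi>" unfolding joint_def by measurable
  show "(\<lambda>\<omega>. fst (snd \<omega>) i) \<in> J \<rightarrow>\<^sub>M rspace" if "i \<in> {1..k}" for i
    by (rule measurable_compose[OF snd private_string_measurable[OF that]])
  show "(\<lambda>\<omega>. snd (snd \<omega>)) \<in> J \<rightarrow>\<^sub>M rspace"
    by (rule measurable_compose[OF snd public_string_measurable])
qed (rule protocol)

text \<open>The samples form a finite discrete space.\<close>

lemma countably_valued_function_of_samples: "countably_valued J (\<lambda>\<omega>. f (fst \<omega>))"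
proof (rule countably_valued_measurable_compose[where N = "\<mu>_pow k n" and g = f])
  show "fst \<in> J \<rightarrow>\<^sub>M \<mu>_pow k n" unfolding joint_def by measurable
  show "countably_valued (\<mu>_pow k n) f"
    by (rule measurable_countably_valued)
      (auto intro: measurable_\<mu>_pow simp: space_\<mu>_pow countable_finite finite_samples)
qed

lemma countably_valued_X_of: "countably_valued J (X_of n)"
proof -
  have "X_of n = (\<lambda>\<omega> i. input_of n i (fst \<omega>))" by (simp add: fun_eq_iff X_of_eq)
  then show ?thesis using countably_valued_function_of_samples[of "\<lambda>z i. input_of n i z"] by simp
qed

lemma countably_valued_final0: "countably_valued J final0"
  unfolding final0_def[abs_def]
  by (rule countably_valued_bind[OF countably_valued_X_of])
    (rule random_strings.countably_valued_final[OF random_strings_J range_s0])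

lemma X_of_measurable: "(\<lambda>\<omega>. X_of n \<omega> i) \<in> J \<rightarrow>\<^sub>M count_space UNIV"
  unfolding X_of_eq by (intro countably_valued_measurable countably_valued_function_of_samples)

lemma input_of_measurable: "input_of n i \<in> \<mu>_pow k n \<rightarrow>\<^sub>M count_space UNIV"
  by (rule measurable_\<mu>_pow) simp

lemma other_inputs_measurable: "other_inputs k n i \<in> \<mu>_pow k n \<rightarrow>\<^sub>M inputs_space i"
  by (rule measurable_\<mu>_pow) (auto simp: other_inputs_def space_PiM)

lemma X_minus_measurable: "X_minus k n i \<in> J \<rightarrow>\<^sub>M inputs_space i"
proof -
  have "fst \<in> J \<rightarrow>\<^sub>M \<mu>_pow k n" unfolding joint_def by measurable
  from measurable_compose[OF this other_inputs_measurable, of i] show ?thesis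
    by (simp add: X_minus_eq[abs_def])
qed

lemma R_of_measurable: "i \<in> {1..k} \<Longrightarrow> (\<lambda>\<omega>. R_of \<omega> i) \<in> J \<rightarrow>\<^sub>M rspace"
  using random_strings.R_measurable[OF random_strings_J] by (simp add: R_of_def case_prod_beta)

lemma R_minus_measurable: "R_minus k i \<in> J \<rightarrow>\<^sub>M PiM (others k i) (\<lambda>_. rspace)"
  unfolding R_minus_def[abs_def]
  by (rule measurable_restrict) (auto simp: others_def intro: R_of_measurable)

lemma transcript_measurable:
  assumes "i \<in> {1..k}"
  shows "transcript k n \<pi> \<sigma> i \<in> J \<rightarrow>\<^sub>M transcript_space k i"
proof -
  have "(\<lambda>\<omega>. (snd (snd \<omega>), \<lambda>j\<in>others k i. (sent (final0 \<omega>) i j, got (final0 \<omega>) i j))) \<in>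
    J \<rightarrow>\<^sub>M transcript_space k i"
    unfolding transcript_space_def
    by (intro measurable_Pair measurable_restrict random_strings.Rp_measurable[OF random_strings_J]
        countably_valued_measurable countably_valued_compose[OF countably_valued_final0])
  then show ?thesis using transcript_eq[OF assms] by (simp add: fun_eq_iff[symmetric] ext[OF transcript_eq[OF assms]])
qed

lemma input_independent_rest:
  assumes i: "i \<in> {1..k}"
  shows "distr J (count_space UNIV \<Otimes>\<^sub>M rest_space i) (\<lambda>\<omega>. (X_of n \<omega> i, (X_minus k n i \<omega>, R_minus k i \<omega>))) =
    distr J (count_space UNIV) (\<lambda>\<omega>. X_of n \<omega> i) \<Otimes>\<^sub>M distr J (rest_space i) (\<lambda>\<omega>. (X_minus k n i \<omega>, R_minus k i \<omega>))"
proof -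
  have R: "R_minus k i \<omega> = restrict (fst (snd \<omega>)) (others k i)" for \<omega>
    by (cases \<omega>) (simp add: R_minus_def R_of_def)
  show ?thesis
    unfolding joint_def X_of_eq X_minus_eq R
    by (rule distr_Pair_eq_pair_distr_independent[OF prob_space_\<mu>_pow prob_space_rand_law
          input_of_measurable other_inputs_measurable other_strings_measurable])
      (rule inputs_independent[OF i])
qed

lemma other_inputs_independent_own:
  assumes i: "i \<in> {1..k}"
  shows "distr J (inputs_space i \<Otimes>\<^sub>M (count_space UNIV \<Otimes>\<^sub>M rspace)) (\<lambda>\<omega>. (X_minus k n i \<omega>, (X_of n \<omega> i, R_of \<omega> i))) =
    distr J (inputs_space i) (X_minus k n i) \<Otimes>\<^sub>M distr J (count_space UNIV \<Otimes>\<^sub>M rspace) (\<lambda>\<omega>. (X_of n \<omega> i, R_of \<omega> i))"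
proof -
  have R: "R_of \<omega> i = fst (snd \<omega>) i" for \<omega>
    by (cases \<omega>) (simp add: R_of_def)
  show ?thesis
    unfolding joint_def X_of_eq X_minus_eq[abs_def] R
    by (rule distr_Pair_eq_pair_distr_independent[OF prob_space_\<mu>_pow prob_space_rand_law
          other_inputs_measurable input_of_measurable private_string_measurable[OF i]])
      (use inputs_independent[OF i, of n] in \<open>simp add: conj_commute mult.commute\<close>)
qed

text \<open>
  Given the transcript of player \<open>i\<close> and everything the other players know, their part of the
  execution can be replayed, with player \<open>i\<close> reduced to sending the recorded messages. The
  replayed output of player 1 and the other inputs then reveal the input of player \<open>i\<close>.
\<close>

definition guess :: "nat \<Rightarrow> nat \<Rightarrow> (rstring \<times> (nat \<Rightarrow> msg list \<times> msg list)) \<times> (nat \<Rightarrow> bool list) \<times> (nat \<Rightarrow> rstring) \<Rightarrow> bool" where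
  "guess i q y =
    ((case run_output (scripted k i (\<lambda>j. fst (snd (fst y) j)) \<pi>) (fst (snd y))
        ((snd (snd y))(i := \<lambda>_. False)) (fst (fst y)) s0 1 of
        Stopped w \<Rightarrow> q < length w \<and> w ! q | _ \<Rightarrow> False)
      \<noteq> odd (card {j\<in>others k i. fst (snd y) j ! q}))"

text \<open>Recorded messages and other inputs take countably many values, so two case distinctions
  turn them into constants. What remains is a replay with random strings, in which the scripted
  player gets a constant string.\<close>

lemma guess_measurable: "Measurable.pred (transcript_space k i \<Otimes>\<^sub>M rest_space i) (guess i q)"
proof -
  let ?T = "transcript_space k i \<Otimes>\<^sub>M rest_space i"
  let ?R = "\<lambda>y :: (rstring \<times> (nat \<Rightarrow> msg list \<times> msg list)) \<times> (nat \<Rightarrow> bool list) \<times> (nat \<Rightarrow> rstring).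
    (snd (snd y))(i := \<lambda>_. False)"
  have rs: "random_strings k (scripted k i \<tau> \<pi>) ?T ?R (\<lambda>y. fst (fst y))" for \<tau>
  proof
    show "is_protocol k (scripted k i \<tau> \<pi>)" by (rule is_protocol_scripted[OF protocol])
    show "(\<lambda>y. fst (fst y)) \<in> ?T \<rightarrow>\<^sub>M rspace" unfolding transcript_space_def by measurable
    show "(\<lambda>y. ?R y j) \<in> ?T \<rightarrow>\<^sub>M rspace" if "j \<in> {1..k}" for j
    proof (cases "j = i")
      case True
      then show ?thesis by (simp add: rspace_def space_PiM)
    next
      case False
      have "(\<lambda>y. snd (snd y) j) \<in> ?T \<rightarrow>\<^sub>M rspace"
        by (rule measurable_compose[OF measurable_compose[OF measurable_snd measurable_snd] measurable_component_singleton])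
          (use that False in \<open>auto simp: others_def\<close>)
      then show ?thesis using False by simp
    qed
  qed
  have \<tau>: "countably_valued ?T (\<lambda>y. snd (fst y))"
    by (rule countably_valued_measurable_compose[OF countably_valued_PiM[OF finite_others[of i]]])
      (simp add: transcript_space_def)
  have xm: "countably_valued ?T (\<lambda>y. fst (snd y))"
    by (rule countably_valued_measurable_compose[OF countably_valued_PiM[OF finite_others[of i]]]) measurable
  have "countably_valued ?T (\<lambda>y. run_output (scripted k i (\<lambda>j. fst (snd (fst y) j)) \<pi>) (fst (snd y)) (?R y) (fst (fst y)) s0 1)"
    by (rule countably_valued_bind[OF \<tau>, where F = "\<lambda>\<tau> y. run_output (scripted k i (\<lambda>j. fst (\<tau> j)) \<pi>) (fst (snd y)) (?R y) (fst (fst y)) s0 1"],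
        rule countably_valued_bind[OF xm, where F = "\<lambda>x y. run_output _ x (?R y) (fst (fst y)) s0 1"])
      (rule random_strings.countably_valued_run_output[OF rs range_s0])
  then have "countably_valued ?T (\<lambda>y. (case run_output (scripted k i (\<lambda>j. fst (snd (fst y) j)) \<pi>) (fst (snd y))
        (?R y) (fst (fst y)) s0 1 of
        Stopped w \<Rightarrow> q < length w \<and> w ! q | _ \<Rightarrow> False)
      \<noteq> odd (card {j\<in>others k i. fst (snd y) j ! q}))"
    by (rule countably_valued_compose2[where h = "\<lambda>st x. (case st of Stopped w \<Rightarrow> q < length w \<and> w ! q | _ \<Rightarrow> False)
      \<noteq> odd (card {j\<in>others k i. x j ! q})"]) (rule xm)
  then show ?thesis
    unfolding guess_def[abs_def] by (rule countably_valued_measurable)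
qed

section \<open>Correct outputs reveal the missing input\<close>

definition correct :: "nat \<Rightarrow> outcome \<Rightarrow> bool" where
  "correct q \<omega> \<longleftrightarrow> (\<exists>w. status (final0 \<omega>) 1 = Stopped w \<and> q < length w \<and> w ! q = Par k n (X_of n \<omega>) ! q)"

lemma correct_measurable: "Measurable.pred J (correct q)"
  unfolding correct_def[abs_def]
  by (intro countably_valued_measurable countably_valued_compose2[OF countably_valued_final0, where
      h = "\<lambda>c x. \<exists>w. status c 1 = Stopped w \<and> q < length w \<and> w ! q = Par k n x ! q"])
    (rule countably_valued_X_of)

text \<open>The guarantee holds for every fixed input, hence on every section of the product space,
  and survives averaging over the inputs.\<close>

lemma prob_correct:
  assumes q: "q < n" and "\<epsilon> < 1"
  shows "1 - \<epsilon> \<le> measure J {\<omega>\<in>space J. correct q \<omega>}"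
proof -
  interpret rand: prob_space "rand_law k \<pi>" by (rule prob_space_rand_law)
  interpret inp: prob_space "\<mu>_pow k n" by (rule prob_space_\<mu>_pow)
  interpret J: prob_space J by (rule prob_space_J)
  have meas: "{\<omega>\<in>space J. correct q \<omega>} \<in> sets (\<mu>_pow k n \<Otimes>\<^sub>M rand_law k \<pi>)"
    using correct_measurable[of q] by (simp add: pred_def joint_def)
  have "ennreal (1 - \<epsilon>) = (\<integral>\<^sup>+z. ennreal (1 - \<epsilon>) \<partial>\<mu>_pow k n)"
    by (simp add: inp.emeasure_space_1)
  also have "\<dots> \<le> (\<integral>\<^sup>+z. emeasure (rand_law k \<pi>) (Pair z -` {\<omega>\<in>space J. correct q \<omega>}) \<partial>\<mu>_pow k n)"
  proof (rule nn_integral_mono)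
    fix z assume z: "z \<in> space (\<mu>_pow k n)"
    let ?x = "\<lambda>i. input_of n i z"
    have x: "X_of n (z, \<rho>) = ?x" for \<rho> using X_of_eq[of "(z, \<rho>)"] by (simp add: fun_eq_iff)
    have "1 - \<epsilon> \<le> measure (rand_law k \<pi>)
      {(r, p) \<in> space (rand_law k \<pi>). \<exists>w. status (final k \<pi> (\<lambda>_ _ _. s0) ?x r p) 1 = Stopped w \<and>
         q < length w \<and> w ! q = Par k n ?x ! q}"
      using computes is_scheduler_s0 q unfolding eps_computes_Par_def
      by (auto simp: input_of_def)
    also have "{(r, p) \<in> space (rand_law k \<pi>). \<exists>w. status (final k \<pi> (\<lambda>_ _ _. s0) ?x r p) 1 = Stopped w \<and>
         q < length w \<and> w ! q = Par k n ?x ! q} = Pair z -` {\<omega>\<in>space J. correct q \<omega>}"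
      using z by (auto simp: joint_def space_pair_measure correct_def final0_def x)
    finally show "ennreal (1 - \<epsilon>) \<le> emeasure (rand_law k \<pi>) (Pair z -` {\<omega>\<in>space J. correct q \<omega>})"
      by (simp add: rand.emeasure_eq_measure ennreal_leI)
  qed
  also have "\<dots> = emeasure J {\<omega>\<in>space J. correct q \<omega>}"
    unfolding joint_def by (rule rand.emeasure_pair_measure_alt[symmetric]) (use meas in \<open>simp add: joint_def\<close>)
  finally show ?thesis by (simp add: J.emeasure_eq_measure)
qed

text \<open>Since \<open>i \<noteq> 1\<close>, player 1 is among the replayed players and its output
  is recovered. Where it is the parity of all bits, its exclusive or with the parity of the other
  bits is the bit of player \<open>i\<close>.\<close>

lemma guess_correct:
  assumes i: "i \<in> {1..k}" "i \<noteq> 1" and q: "q < n" and c: "correct q \<omega>"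
  shows "guess i q (transcript k n \<pi> \<sigma> i \<omega>, (X_minus k n i \<omega>, R_minus k i \<omega>)) = X_of n \<omega> i ! q"
proof -
  obtain z r p where \<omega>: "\<omega> = (z, r, p)" by (cases \<omega>) auto
  have one: "1 \<in> others k i" using i by (auto simp: others_def)
  let ?T = "\<lambda>j. fst (snd (transcript k n \<pi> \<sigma> i \<omega>) j)"
  have "run_output (scripted k i ?T \<pi>) (X_minus k n i \<omega>) ((R_minus k i \<omega>)(i := \<lambda>_. False)) p s0 1 =
    status (final k \<pi> (\<lambda>_ _ _. s0) (X_of n \<omega>) r p) 1"
    by (rule scripted_output[OF protocol fair_s0 halts[OF is_scheduler_s0] i(1) one])
      (auto simp: transcript_eq[OF i(1)] final0_def \<omega> X_minus_def R_minus_def R_of_def others_def)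
  then have out: "run_output (scripted k i ?T \<pi>) (X_minus k n i \<omega>) ((R_minus k i \<omega>)(i := \<lambda>_. False))
      (fst (transcript k n \<pi> \<sigma> i \<omega>)) s0 1 = status (final0 \<omega>) 1"
    by (simp add: final0_def \<omega> transcript_eq[OF i(1)])
  obtain w where w: "status (final0 \<omega>) 1 = Stopped w" "q < length w" "w ! q = Par k n (X_of n \<omega>) ! q"
    using c by (auto simp: correct_def)
  have split: "{j\<in>{1..k}. X_of n \<omega> j ! q} =
    {j\<in>others k i. X_of n \<omega> j ! q} \<union> (if X_of n \<omega> i ! q then {i} else {})"
    using i(1) by (auto simp: others_def)
  have card: "card {j\<in>{1..k}. X_of n \<omega> j ! q} =
    card {j\<in>others k i. X_of n \<omega> j ! q} + (if X_of n \<omega> i ! q then 1 else 0)"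
    unfolding split by (subst card_Un_disjoint) (auto simp: others_def)
  have others_eq: "{j\<in>others k i. X_minus k n i \<omega> j ! q} = {j\<in>others k i. X_of n \<omega> j ! q}"
    by (auto simp: X_minus_def)
  have "w ! q \<longleftrightarrow> odd (card {j\<in>{1..k}. X_of n \<omega> j ! q})" using w(3) q by (simp add: Par_def)
  then show ?thesis
    unfolding guess_def fst_conv snd_conv out others_eq using w(1,2) card by auto
qed

lemma information_about_input:
  assumes i: "i \<in> {1..k}" "i \<noteq> 1" and \<epsilon>: "\<epsilon> < 1" and \<eta>: "0 < \<eta>" "\<eta> < 1"
  shows "real n * ((1 - \<epsilon>) * log 2 (1 + \<eta>) + \<epsilon> * log 2 (1 - \<eta>)) \<le>
    prob_space.mutual_information J 2 (count_space UNIV) (transcript_space k i \<Otimes>\<^sub>M rest_space i)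
      (\<lambda>\<omega>. X_of n \<omega> i) (\<lambda>\<omega>. (transcript k n \<pi> \<sigma> i \<omega>, (X_minus k n i \<omega>, R_minus k i \<omega>)))"
proof -
  interpret J: prob_space J by (rule prob_space_J)
  let ?Y = "\<lambda>\<omega>. (transcript k n \<pi> \<sigma> i \<omega>, (X_minus k n i \<omega>, R_minus k i \<omega>))"
  note [measurable] = transcript_measurable[OF i(1)] X_minus_measurable R_minus_measurable X_of_measurable guess_measurable
  have Y[measurable]: "?Y \<in> J \<rightarrow>\<^sub>M transcript_space k i \<Otimes>\<^sub>M rest_space i" by measurable
  show ?thesis
  proof (rule J.mutual_information_ge_guess[where guess = "guess i", OF X_of_measurable Y])
    show "length (X_of n \<omega> i) = n" for \<omega> by (rule length_X_of)
    show "Measurable.pred (transcript_space k i \<Otimes>\<^sub>M rest_space i) (guess i q)" for q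
      by (rule guess_measurable)
    fix u :: "bool list" assume u: "length u = n"
    have "{\<omega>\<in>space J. X_of n \<omega> i = u} =
      {z\<in>space (\<mu>_pow k n). input_of n i z = u} \<times> space (rand_law k \<pi>)"
      by (auto simp: joint_def space_pair_measure X_of_eq)
    moreover have "{z\<in>space (\<mu>_pow k n). input_of n i z = u} \<in> sets (\<mu>_pow k n)"
      using input_of_measurable[of i] by measurable
    ultimately have "emeasure J {\<omega>\<in>space J. X_of n \<omega> i = u} = emeasure (\<mu>_pow k n) {z\<in>space (\<mu>_pow k n). input_of n i z = u}"
      using prob_space_rand_law prob_space_imp_sigma_finite[OF prob_space_rand_law]
      by (simp add: joint_def sigma_finite_measure.emeasure_pair_measure_Times prob_space.emeasure_space_1)
    then show "measure J {\<omega>\<in>space J. X_of n \<omega> i = u} = 1 / 2 ^ n"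
      using input_uniform[OF i(1) u] by (simp add: measure_def)
  next
    fix q assume q: "q < n"
    have "{\<omega>\<in>space J. guess i q (?Y \<omega>) = X_of n \<omega> i ! q} \<in> sets J"
    proof -
      have [measurable]: "Measurable.pred J (\<lambda>\<omega>. guess i q (?Y \<omega>))"
        by (rule measurable_compose[OF Y guess_measurable])
      have [measurable]: "Measurable.pred J (\<lambda>\<omega>. X_of n \<omega> i ! q)"
        by (rule measurable_compose[OF X_of_measurable]) simp
      show ?thesis by measurable
    qed
    \<comment> \<open>Only an inclusion of events: where the output has no entry \<open>q\<close>,
      the default \<open>False\<close> in the guess may still lead to the right bit.\<close>
    then have "measure J {\<omega>\<in>space J. correct q \<omega>} \<le> measure J {\<omega>\<in>space J. guess i q (?Y \<omega>) = X_of n \<omega> i ! q}"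
      by (intro J.finite_measure_mono) (use guess_correct[OF i q] in auto)
    then show "1 - \<epsilon> \<le> measure J {\<omega>\<in>space J. guess i q (?Y \<omega>) = X_of n \<omega> i ! q}"
      using prob_correct[OF q \<epsilon>] by linarith
  qed (rule \<eta>)+
qed

text \<open>\<open>conditional_mutual_information\<close> is by definition I(X; YZ) - I(X; Z). Here
  I(X; Z) vanishes, because the inputs in X are independent of the other inputs and of the strings
  in Z.\<close>

lemma MIC_eq: "MIC k n \<pi> \<sigma> = (\<Sum>i=1..k.
    prob_space.mutual_information J 2 (inputs_space i) (transcript_space k i \<Otimes>\<^sub>M (count_space UNIV \<Otimes>\<^sub>M rspace))
      (X_minus k n i) (\<lambda>\<omega>. (transcript k n \<pi> \<sigma> i \<omega>, (X_of n \<omega> i, R_of \<omega> i))) +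
    prob_space.mutual_information J 2 (count_space UNIV) (transcript_space k i \<Otimes>\<^sub>M rest_space i)
      (\<lambda>\<omega>. X_of n \<omega> i) (\<lambda>\<omega>. (transcript k n \<pi> \<sigma> i \<omega>, (X_minus k n i \<omega>, R_minus k i \<omega>))))"
proof -
  interpret J: prob_space J by (rule prob_space_J)
  show ?thesis
    unfolding MIC_def J.conditional_mutual_information_def
  proof (intro sum.cong refl arg_cong2[where f = "(+)"])
    fix i assume i: "i \<in> {1..k}"
    note [measurable] = X_minus_measurable R_minus_measurable X_of_measurable R_of_measurable[OF i]
    have "J.mutual_information 2 (inputs_space i) (count_space UNIV \<Otimes>\<^sub>M rspace) (X_minus k n i)
        (\<lambda>\<omega>. (X_of n \<omega> i, R_of \<omega> i)) = 0"
      by (rule J.mutual_information_indep_eq_0[OF _ _ other_inputs_independent_own[OF i]]) measurable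
    then show "J.mutual_information 2 (inputs_space i) (transcript_space k i \<Otimes>\<^sub>M (count_space UNIV \<Otimes>\<^sub>M rspace))
        (X_minus k n i) (\<lambda>\<omega>. (transcript k n \<pi> \<sigma> i \<omega>, (X_of n \<omega> i, R_of \<omega> i))) -
      J.mutual_information 2 (inputs_space i) (count_space UNIV \<Otimes>\<^sub>M rspace) (X_minus k n i)
        (\<lambda>\<omega>. (X_of n \<omega> i, R_of \<omega> i)) =
      J.mutual_information 2 (inputs_space i) (transcript_space k i \<Otimes>\<^sub>M (count_space UNIV \<Otimes>\<^sub>M rspace))
        (X_minus k n i) (\<lambda>\<omega>. (transcript k n \<pi> \<sigma> i \<omega>, (X_of n \<omega> i, R_of \<omega> i)))" by simp
    have "J.mutual_information 2 (count_space UNIV) (rest_space i) (\<lambda>\<omega>. X_of n \<omega> i)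
        (\<lambda>\<omega>. (X_minus k n i \<omega>, R_minus k i \<omega>)) = 0"
      by (rule J.mutual_information_indep_eq_0[OF _ _ input_independent_rest[OF i]]) measurable
    then show "J.mutual_information 2 (count_space UNIV) (transcript_space k i \<Otimes>\<^sub>M rest_space i)
        (\<lambda>\<omega>. X_of n \<omega> i) (\<lambda>\<omega>. (transcript k n \<pi> \<sigma> i \<omega>, (X_minus k n i \<omega>, R_minus k i \<omega>))) -
      J.mutual_information 2 (count_space UNIV) (rest_space i) (\<lambda>\<omega>. X_of n \<omega> i)
        (\<lambda>\<omega>. (X_minus k n i \<omega>, R_minus k i \<omega>)) =
      J.mutual_information 2 (count_space UNIV) (transcript_space k i \<Otimes>\<^sub>M rest_space i)
        (\<lambda>\<omega>. X_of n \<omega> i) (\<lambda>\<omega>. (transcript k n \<pi> \<sigma> i \<omega>, (X_minus k n i \<omega>, R_minus k i \<omega>)))" by simp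
  qed
qed

lemma MIC_ge:
  assumes k: "2 \<le> k" and \<epsilon>: "\<epsilon> < 1" and \<eta>: "0 < \<eta>" "\<eta> < 1"
  defines "c \<equiv> (1 - \<epsilon>) * log 2 (1 + \<eta>) + \<epsilon> * log 2 (1 - \<eta>)"
  shows "real (k - 1) * (real n * c) \<le> MIC k n \<pi> \<sigma>"
proof -
  interpret J: prob_space J by (rule prob_space_J)
  define a where "a i = J.mutual_information 2 (inputs_space i) (transcript_space k i \<Otimes>\<^sub>M (count_space UNIV \<Otimes>\<^sub>M rspace))
      (X_minus k n i) (\<lambda>\<omega>. (transcript k n \<pi> \<sigma> i \<omega>, (X_of n \<omega> i, R_of \<omega> i)))" for i
  define b where "b i = J.mutual_information 2 (count_space UNIV) (transcript_space k i \<Otimes>\<^sub>M rest_space i)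
      (\<lambda>\<omega>. X_of n \<omega> i) (\<lambda>\<omega>. (transcript k n \<pi> \<sigma> i \<omega>, (X_minus k n i \<omega>, R_minus k i \<omega>)))" for i
  have fst_mem: "fst \<omega> \<in> samples k n" if "\<omega> \<in> space J" for \<omega>
    using that by (auto simp: joint_def space_pair_measure space_\<mu>_pow)
  have a: "0 \<le> a i" if i: "i \<in> {1..k}" for i
  proof -
    note [measurable] = transcript_measurable[OF i] X_minus_measurable X_of_measurable R_of_measurable[OF i]
    show ?thesis unfolding a_def
    proof (rule J.mutual_information_nonneg_finite_range[where F = "other_inputs k n i ` samples k n"])
      show "{u} \<in> sets (inputs_space i)" if "u \<in> other_inputs k n i ` samples k n" for u
        using that by (auto simp: PiM_count_space_UNIV[OF finite_others] other_inputs_def)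
      show "X_minus k n i \<omega> \<in> other_inputs k n i ` samples k n" if "\<omega> \<in> space J" for \<omega>
        using fst_mem[OF that] by (simp add: X_minus_eq)
    qed (simp_all add: finite_samples)
  qed
  have b0: "0 \<le> b i" if i: "i \<in> {1..k}" for i
  proof -
    note [measurable] = transcript_measurable[OF i] X_minus_measurable X_of_measurable R_minus_measurable
    show ?thesis unfolding b_def
    proof (rule J.mutual_information_nonneg_finite_range[where F = "input_of n i ` samples k n"])
      show "X_of n \<omega> i \<in> input_of n i ` samples k n" if "\<omega> \<in> space J" for \<omega>
        using fst_mem[OF that] by (simp add: X_of_eq)
    qed (simp_all add: finite_samples)
  qed
  have b: "real n * c \<le> b i" if "i \<in> {2..k}" for i
    unfolding b_def c_def using that by (intro information_about_input \<epsilon> \<eta>) auto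
  have "real (k - 1) * (real n * c) = (\<Sum>i\<in>{2..k}. real n * c)" by simp
  also have "\<dots> \<le> (\<Sum>i\<in>{2..k}. b i)" by (rule sum_mono) (rule b)
  also have "\<dots> \<le> (\<Sum>i\<in>{1..k}. a i + b i)"
    using a b0 by (intro order.trans[OF sum_mono2[of "{1..k}" "{2..k}" b] sum_mono]) auto
  finally show ?thesis by (simp add: MIC_eq a_def b_def)
qed

end

theorem theorem4p2:
  fixes \<epsilon> :: real
  assumes "0 \<le> \<epsilon>" and "\<epsilon> < 1 / 2"
  shows "\<exists>c>0. \<forall>(k::nat) (n::nat) (\<pi>::protocol) (\<sigma>::scheduler).
           k \<ge> 2 \<longrightarrow> is_protocol k \<pi> \<longrightarrow> eps_computes_Par k n \<epsilon> \<pi> \<longrightarrow> is_scheduler k \<sigma> \<longrightarrow>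
           MIC k n \<pi> \<sigma> \<ge> c * real k * real n"
proof -
  define \<eta> where "\<eta> = (1 - 2 * \<epsilon>) / 4"
  define c where "c = (1 - \<epsilon>) * log 2 (1 + \<eta>) + \<epsilon> * log 2 (1 - \<eta>)"
  have c: "0 < c" unfolding c_def \<eta>_def by (rule guess_bound_pos[OF assms])
  show ?thesis
  \<comment> \<open>Half of \<open>c\<close>, because \<open>k - 1 \<ge> k / 2\<close> for
    \<open>k \<ge> 2\<close>. A single player can output its own input without communicating, so no
    such bound holds for \<open>k = 1\<close>.\<close>
  proof (intro exI[of _ "c / 2"] conjI allI impI)
    fix k n \<pi> \<sigma>
    assume k: "2 \<le> k" and "is_protocol k \<pi>" "eps_computes_Par k n \<epsilon> \<pi>" "is_scheduler k \<sigma>"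
    then interpret parity_protocol k n \<epsilon> \<pi> \<sigma> by unfold_locales
    have "c / 2 * real k * real n = (real k / 2) * (real n * c)" by simp
    also have "\<dots> \<le> real (k - 1) * (real n * c)" using k c by (intro mult_right_mono) auto
    also have "\<dots> \<le> MIC k n \<pi> \<sigma>"
      unfolding c_def by (rule MIC_ge) (use k assms in \<open>auto simp: \<eta>_def\<close>)
    finally show "c / 2 * real k * real n \<le> MIC k n \<pi> \<sigma>" .
  qed (use c in simp)
qed

end
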